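(* For each $\alpha\in[0,1)$, $\textsc{Min-CVaR}_\alpha~\mathcal{P}$ with uncertain due dates is approximable within $\rho=\min\{\frac{1}{{\rm Pr}_{\min}},\frac{1}{1-\alpha}\}$ when $\mathcal{P}\in\{1|p_j=1|\sum w_jU_j,\;1|p_j=1|\sum w_jT_j\}$.
   Context: Single machine scheduling: a set $J$ of $n$ jobs with unit processing times and deterministic nonnegative weights $w_j$; a schedule $\pi$ is a permutation of $J$ processed without idle time from time 0, with completion times $C_j(\pi)$. A scenario set $\mathcal{U}=\{\xi_1,\dots,\xi_K\}$ (part of the input) specifies nonnegative due dates $d_j(\xi)$, with probabilities ${\rm Pr}[\xi_i]>0$ summing to 1; ${\rm Pr}_{\min}=\min_i{\rm Pr}[\xi_i]$. $T_j(\pi,\xi)=\max\{0,C_j(\pi)-d_j(\xi)\}$, $U_j(\pi,\xi)=1$ if $C_j(\pi)>d_j(\xi)$ else $0$. The cost $f(\pi,\xi)$ is $\sum_jw_jU_j(\pi,\xi)$ or $\sum_jw_jT_j(\pi,\xi)$. ${\rm F}(\pi)$ is the random variable equal to $f(\pi,\xi_i)$ with probability ${\rm Pr}[\xi_i]$. $\textsc{Min-CVaR}_\alpha~\mathcal{P}$: minimize $\mathbf{CVaR}_\alpha[{\rm F}(\pi)]=\inf_{\gamma\in\mathbb{R}}\{\gamma+\frac{1}{1-\alpha}\mathbf{E}[({\rm F}(\pi)-\gamma)^+]\}$. "Approximable within $\rho$": a polynomial-time algorithm returns a schedule of objective value at most $\rho$ times the optimum. *)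

theory Defs
  imports
    "HOL-Probability.Probability"
    "HOL-Computational_Algebra.Polynomial"
    "HOL-Combinatorics.Multiset_Permutations"
    "HOL-Library.Log_Nat"
begin

section \<open>Polynomial-time algorithms\<close>

text \<open>
  The machine model is a first-order, call-by-value functional language with mutually recursive
  functions over integers and binary cons cells. Every evaluation step costs one unit, and an
  arithmetic operation costs in addition the bit length of its operands (logarithmic cost
  criterion). Cons cells are immutable and never copied or compared as a whole, so they can be
  represented by pointers into a heap; hence the model and multitape Turing machines simulate each
  other with polynomial overhead, and polynomial time has its usual meaning.
\<close>

datatype val = VInt int | VNil | VCons val val

definition int_size :: "int \<Rightarrow> nat" where
  "int_size i = 1 + floorlog 2 (nat \<bar>i\<bar>)"

primrec val_size :: "val \<Rightarrow> nat" where
  "val_size (VInt i) = int_size i"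
| "val_size VNil = 1"
| "val_size (VCons a b) = 1 + val_size a + val_size b"

datatype arith_op = Add | Sub | Mul | Div | Less

primrec arith :: "arith_op \<Rightarrow> int \<Rightarrow> int \<Rightarrow> int" where
  "arith Add x y = x + y"
| "arith Sub x y = x - y"
| "arith Mul x y = x * y"
| "arith Div x y = x div y"
| "arith Less x y = (if x < y then 1 else 0)"

text \<open>
  Variables are de Bruijn indices into the environment. \<^term>\<open>ELet a b\<close> binds the value of \<open>a\<close> in
  \<open>b\<close>; \<^term>\<open>ECase e a b\<close> evaluates \<open>a\<close> if \<open>e\<close> is nil, and otherwise \<open>b\<close> with head and tail bound to
  the indices 0 and 1. \<^term>\<open>ECall f a\<close> calls the \<open>f\<close>-th function of the program; functions are
  unary, and the body sees only its argument.
\<close>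

datatype expr =
    EVar nat
  | ELit int
  | EOp arith_op expr expr
  | EIf expr expr expr
  | ENil
  | ECons expr expr
  | ECase expr expr expr
  | ELet expr expr
  | ECall nat expr

type_synonym program = "expr list"

inductive evaluates :: "program \<Rightarrow> val list \<Rightarrow> expr \<Rightarrow> val \<Rightarrow> nat \<Rightarrow> bool" for P where
  Var: "i < length \<Gamma> \<Longrightarrow> evaluates P \<Gamma> (EVar i) (\<Gamma> ! i) 1"
| Lit: "evaluates P \<Gamma> (ELit c) (VInt c) 1"
| Op: "evaluates P \<Gamma> a (VInt x) s \<Longrightarrow> evaluates P \<Gamma> b (VInt y) t \<Longrightarrow>
    evaluates P \<Gamma> (EOp f a b) (VInt (arith f x y)) (1 + s + t + int_size x + int_size y)"
| If_True: "evaluates P \<Gamma> c (VInt x) s \<Longrightarrow> x \<noteq> 0 \<Longrightarrow> evaluates P \<Gamma> a v t \<Longrightarrow>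
    evaluates P \<Gamma> (EIf c a b) v (1 + s + t)"
| If_False: "evaluates P \<Gamma> c (VInt 0) s \<Longrightarrow> evaluates P \<Gamma> b v t \<Longrightarrow>
    evaluates P \<Gamma> (EIf c a b) v (1 + s + t)"
| Nil: "evaluates P \<Gamma> ENil VNil 1"
| Cons: "evaluates P \<Gamma> a u s \<Longrightarrow> evaluates P \<Gamma> b v t \<Longrightarrow>
    evaluates P \<Gamma> (ECons a b) (VCons u v) (1 + s + t)"
| Case_Nil: "evaluates P \<Gamma> e VNil s \<Longrightarrow> evaluates P \<Gamma> a v t \<Longrightarrow>
    evaluates P \<Gamma> (ECase e a b) v (1 + s + t)"
| Case_Cons: "evaluates P \<Gamma> e (VCons h l) s \<Longrightarrow> evaluates P (h # l # \<Gamma>) b v t \<Longrightarrow>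
    evaluates P \<Gamma> (ECase e a b) v (1 + s + t)"
| Let: "evaluates P \<Gamma> a u s \<Longrightarrow> evaluates P (u # \<Gamma>) b v t \<Longrightarrow>
    evaluates P \<Gamma> (ELet a b) v (1 + s + t)"
| Call: "evaluates P \<Gamma> a u s \<Longrightarrow> f < length P \<Longrightarrow> evaluates P [u] (P ! f) v t \<Longrightarrow>
    evaluates P \<Gamma> (ECall f a) v (1 + s + t)"

inductive_cases evaluates_elims:
  "evaluates P \<Gamma> (EVar i) v t"
  "evaluates P \<Gamma> (ELit c) v t"
  "evaluates P \<Gamma> (EOp f a b) v t"
  "evaluates P \<Gamma> (EIf c a b) v t"
  "evaluates P \<Gamma> ENil v t"
  "evaluates P \<Gamma> (ECons a b) v t"
  "evaluates P \<Gamma> (ECase e a b) v t"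
  "evaluates P \<Gamma> (ELet a b) v t"
  "evaluates P \<Gamma> (ECall f a) v t"

lemma evaluates_deterministic:
  "evaluates P \<Gamma> e v t \<Longrightarrow> evaluates P \<Gamma> e v' t' \<Longrightarrow> v' = v \<and> t' = t"
proof (induction arbitrary: v' t' rule: evaluates.induct)
  case Var then show ?case by (auto elim: evaluates_elims(1))
next
  case Lit then show ?case by (auto elim: evaluates_elims(2))
next
  case Op from Op.prems show ?case by (rule evaluates_elims(3)) (auto dest!: Op.IH)
next
  case If_True from If_True.prems show ?case
    by (rule evaluates_elims(4)) (use If_True.hyps in \<open>auto dest!: If_True.IH\<close>)
next
  case If_False from If_False.prems show ?case by (rule evaluates_elims(4)) (auto dest!: If_False.IH)
next
  case Nil then show ?case by (auto elim: evaluates_elims(5))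
next
  case Cons from Cons.prems show ?case by (rule evaluates_elims(6)) (auto dest!: Cons.IH)
next
  case Case_Nil from Case_Nil.prems show ?case by (rule evaluates_elims(7)) (auto dest!: Case_Nil.IH)
next
  case Case_Cons from Case_Cons.prems show ?case by (rule evaluates_elims(7)) (auto dest!: Case_Cons.IH)
next
  case Let from Let.prems show ?case by (rule evaluates_elims(8)) (auto dest!: Let.IH)
next
  case Call from Call.prems show ?case by (rule evaluates_elims(9)) (auto dest!: Call.IH)
qed

text \<open>On input \<open>x\<close>, the program returns \<open>v\<close> after time \<open>t\<close>; its main function is the first one.\<close>

definition returns :: "program \<Rightarrow> val \<Rightarrow> val \<Rightarrow> nat \<Rightarrow> bool" where
  "returns P x v t \<longleftrightarrow> evaluates P [x] (ECall 0 (EVar 0)) v t"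

text \<open>
  A minimization problem is given by its instances \<open>X\<close>, the feasible solutions \<open>sol x\<close> of an
  instance, the objective \<open>obj x\<close>, and encodings of instances and solutions as machine values.
  The ratio \<open>\<rho>\<close> may depend on the instance.
\<close>

definition approximable_within ::
  "'x set \<Rightarrow> ('x \<Rightarrow> val) \<Rightarrow> ('x \<Rightarrow> 's set) \<Rightarrow> ('s \<Rightarrow> val) \<Rightarrow> ('x \<Rightarrow> 's \<Rightarrow> real) \<Rightarrow> ('x \<Rightarrow> real) \<Rightarrow> bool"
where
  "approximable_within X enc sol enc_sol obj \<rho> \<longleftrightarrow>
    (\<exists>P. \<exists>q :: nat poly. \<forall>x\<in>X. \<exists>s\<in>sol x. \<exists>t.
       returns P (enc x) (enc_sol s) t \<and> t \<le> poly q (val_size (enc x)) \<and>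
       obj x s \<le> \<rho> x * (INF s'\<in>sol x. obj x s'))"


section \<open>Single machine scheduling with unit processing times and uncertain due dates\<close>

text \<open>
  The jobs are \<open>0, \<dots>, n - 1\<close>. A scenario is a pair of its probability and the list of the due
  dates of the jobs. All numbers of the input are rational, with numerators and denominators
  encoded in binary.
\<close>

record sched_instance =
  weights :: "rat list"
  scenarios :: "(rat \<times> rat list) list"

definition num_jobs :: "sched_instance \<Rightarrow> nat" where
  "num_jobs I = length (weights I)"

definition sched_instances :: "sched_instance set" where
  "sched_instances = {I.
     (\<forall>w\<in>set (weights I). 0 \<le> w) \<and>
     (\<forall>(p, d)\<in>set (scenarios I). 0 < p \<and> length d = num_jobs I \<and> (\<forall>x\<in>set d. 0 \<le> x)) \<and>
     (\<Sum>(p, d)\<leftarrow>scenarios I. p) = 1}"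

text \<open>A schedule lists the jobs in the order in which they are processed.\<close>

definition schedules :: "sched_instance \<Rightarrow> nat list set" where
  "schedules I = permutations_of_set {..<num_jobs I}"

definition completion_time :: "nat list \<Rightarrow> nat \<Rightarrow> nat" where
  "completion_time \<pi> j = length (takeWhile (\<lambda>i. i \<noteq> j) \<pi>) + 1"

definition tardiness :: "nat list \<Rightarrow> rat list \<Rightarrow> nat \<Rightarrow> real" where
  "tardiness \<pi> d j = max 0 (real (completion_time \<pi> j) - of_rat (d ! j))"

definition unit_penalty :: "nat list \<Rightarrow> rat list \<Rightarrow> nat \<Rightarrow> real" where
  "unit_penalty \<pi> d j = (if real (completion_time \<pi> j) > of_rat (d ! j) then 1 else 0)"

definition weighted_tardy_jobs :: "sched_instance \<Rightarrow> nat list \<Rightarrow> rat list \<Rightarrow> real" where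
  "weighted_tardy_jobs I \<pi> d = (\<Sum>j<num_jobs I. of_rat (weights I ! j) * unit_penalty \<pi> d j)"

definition weighted_tardiness :: "sched_instance \<Rightarrow> nat list \<Rightarrow> rat list \<Rightarrow> real" where
  "weighted_tardiness I \<pi> d = (\<Sum>j<num_jobs I. of_rat (weights I ! j) * tardiness \<pi> d j)"

definition Pr_min :: "sched_instance \<Rightarrow> real" where
  "Pr_min I = Min ((\<lambda>(p, d). of_rat p) ` set (scenarios I))"

definition random_cost ::
  "(sched_instance \<Rightarrow> nat list \<Rightarrow> rat list \<Rightarrow> real) \<Rightarrow> sched_instance \<Rightarrow> nat list \<Rightarrow> real pmf"
where
  "random_cost f I \<pi> = pmf_of_list (map (\<lambda>(p, d). (f I \<pi> d, of_rat p)) (scenarios I))"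

text \<open>\<^const>\<open>pmf_of_list\<close> is only specified on well-formed lists.\<close>

lemma pmf_of_list_wf_random_cost:
  assumes "I \<in> sched_instances"
  shows "pmf_of_list_wf (map (\<lambda>(p, d). (f I \<pi> d, of_rat p :: real)) (scenarios I))"
proof -
  have sum: "sum_list (map snd (map (\<lambda>(p, d). (f I \<pi> d, of_rat p :: real)) xs)) =
      of_rat (\<Sum>(p, d)\<leftarrow>xs. p)" for xs
    by (induction xs) (auto simp: of_rat_add)
  have "0 < p" if "(p, d) \<in> set (scenarios I)" for p d
    using assms that unfolding sched_instances_def by blast
  then have "\<forall>x\<in>set (map snd (map (\<lambda>(p, d). (f I \<pi> d, of_rat p :: real)) (scenarios I))). 0 \<le> x"
    by (auto simp: less_imp_le)
  moreover have "(\<Sum>(p, d)\<leftarrow>scenarios I. p) = 1"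
    using assms unfolding sched_instances_def by blast
  ultimately show ?thesis
    unfolding pmf_of_list_wf_def sum by (simp only: of_rat_1 simp_thms)
qed

definition CVaR :: "real \<Rightarrow> real pmf \<Rightarrow> real" where
  "CVaR \<alpha> F = (INF \<gamma>. \<gamma> + 1 / (1 - \<alpha>) * measure_pmf.expectation F (\<lambda>x. max 0 (x - \<gamma>)))"


subsection \<open>Encoding of instances and schedules\<close>

primrec enc_list :: "val list \<Rightarrow> val" where
  "enc_list [] = VNil"
| "enc_list (x # xs) = VCons x (enc_list xs)"

definition enc_rat :: "rat \<Rightarrow> val" where
  "enc_rat r = (case quotient_of r of (a, b) \<Rightarrow> VCons (VInt a) (VInt b))"

definition enc_instance :: "sched_instance \<Rightarrow> val" where
  "enc_instance I =
    VCons (enc_list (map enc_rat (weights I)))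
      (enc_list (map (\<lambda>(p, d). VCons (enc_rat p) (enc_list (map enc_rat d))) (scenarios I)))"

definition enc_schedule :: "nat list \<Rightarrow> val" where
  "enc_schedule \<pi> = enc_list (map (\<lambda>j. VInt (int j)) \<pi>)"

end

theory Submission
  imports Defs
begin

text \<open>
  The conditional value at risk of a nonnegative cost lies between its expectation and
  \<open>min (1 / Pr_min) (1 / (1 - \<alpha>))\<close> times its expectation: \<open>\<gamma> = 0\<close> gives the factor \<open>1 / (1 - \<alpha>)\<close>,
  and \<open>\<gamma> = E[F] / Pr_min\<close> dominates every outcome, which gives the other one. Hence a schedule of
  minimum expected cost is good enough.

  By linearity the expected cost is a sum, over the positions, of a cost that depends only on the
  position and on the job placed there, so that such a schedule solves a linear assignment problem;
  multiplying by a common denominator of all input numbers makes it integral. The problem is solved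
  by the Hungarian method, whose dual variables certify optimality. A dual step enlarges the
  dual variables at most by the factor 4 and there are at most \<open>n\<^sup>2\<close> of them, so that all
  integers keep a polynomial bit length.
\<close>

section \<open>Conditional value at risk and expectation\<close>

text \<open>The CVaR couples the scenarios, so it does not split into contributions of single jobs;
  the expectation does, and that is why it is minimized instead. Most of the work goes into the
  running time. Polynomial time is shown for an explicit program in a model that charges for bit
  lengths, so every operand needs a bound before the run, and correctness and size bounds go through
  the same inductions. This favours crude but simple choices: the common denominator is a plain
  product, every tree node carries a whole matching, and every dual step rescans all pairs of a tree
  job and an unreached position. The dual variables are not bounded sharply either: a bound that is
  exponential in \<open>n * n\<close> has a bit length quadratic in \<open>n\<close>. Both cost
  functions share the whole program except for one function, which computes the penalty of a due
  date at a position. The proof is therefore parametric in that function, in the integer penalty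
  that it computes, and in the factor \<open>\<kappa>\<close> by which this differs from the true
  penalty.\<close>

lemma expectation_pmf_of_list:
  fixes g :: "'a \<Rightarrow> real"
  assumes "pmf_of_list_wf xs"
  shows "measure_pmf.expectation (pmf_of_list xs) g = (\<Sum>(x, p)\<leftarrow>xs. p * g x)"
proof -
  have sub: "set_pmf (pmf_of_list xs) \<subseteq> fst ` set xs" using set_pmf_of_list[OF assms] by simp
  have "measure_pmf.expectation (pmf_of_list xs) g =
      (\<Sum>a\<in>fst ` set xs. g a * pmf (pmf_of_list xs) a)"
    using sub by (intro integral_measure_pmf_real) auto
  also have "\<dots> = (\<Sum>a\<in>fst ` set xs. g a * (\<Sum>(x, p)\<leftarrow>filter (\<lambda>z. fst z = a) xs. p))"
    by (simp add: pmf_pmf_of_list[OF assms] case_prod_unfold)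
  also have "\<dots> = (\<Sum>(x, p)\<leftarrow>xs. p * g x)"
  proof -
    \<comment> \<open>Different entries of the list may carry the same value, so their probabilities
      are collected by \<open>filter\<close>. The index set is generalized to any finite
      \<open>A\<close> covering the values, because the set of values shrinks along the
      induction.\<close>
    have "(\<Sum>a\<in>A. g a * (\<Sum>(x, p)\<leftarrow>filter (\<lambda>z. fst z = a) ys. p)) = (\<Sum>(x, p)\<leftarrow>ys. p * g x)"
      if "finite A" "fst ` set ys \<subseteq> A" for A ys
      using that(2)
    proof (induction ys)
      case (Cons y ys)
      obtain x p where y: "y = (x, p)" by (cases y)
      have "(\<Sum>a\<in>A. g a * (\<Sum>(x, p)\<leftarrow>filter (\<lambda>z. fst z = a) (y # ys). p)) =
          (\<Sum>a\<in>A. (if a = x then p * g x else 0) + g a * (\<Sum>(x, p)\<leftarrow>filter (\<lambda>z. fst z = a) ys. p))"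
        by (intro sum.cong) (auto simp: y algebra_simps)
      also have "\<dots> = p * g x + (\<Sum>(x, p)\<leftarrow>ys. p * g x)"
        using Cons that(1) by (simp add: sum.distrib y)
      finally show ?case by (simp add: y)
    qed simp
    then show ?thesis by blast
  qed
  finally show ?thesis .
qed

context
  fixes F :: "real pmf" and \<alpha> :: real
  assumes fin: "finite (set_pmf F)" and \<alpha>: "0 \<le> \<alpha>" "\<alpha> < 1"
begin

text \<open>Pointwise \<open>x - \<gamma> \<le> max 0 (x - \<gamma>)\<close>, and the factor
  \<open>1 / (1 - \<alpha>)\<close> is at least 1. As the bound is free of \<open>\<gamma>\<close>,
  it also supplies the lower bound that the infimum in \<open>CVaR\<close> needs for
  \<open>CVaR_le\<close>.\<close>

lemma expectation_le_CVaR_objective: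
  "measure_pmf.expectation F (\<lambda>x. x) \<le>
    \<gamma> + 1 / (1 - \<alpha>) * measure_pmf.expectation F (\<lambda>x. max 0 (x - \<gamma>))"
proof -
  note int = integrable_measure_pmf_finite[OF fin]
  have "measure_pmf.expectation F (\<lambda>x. x) = \<gamma> + measure_pmf.expectation F (\<lambda>x. x - \<gamma>)"
    by (simp add: int)
  also have "measure_pmf.expectation F (\<lambda>x. x - \<gamma>) \<le> measure_pmf.expectation F (\<lambda>x. max 0 (x - \<gamma>))"
    by (intro integral_mono int) auto
  also have "\<dots> \<le> 1 / (1 - \<alpha>) * measure_pmf.expectation F (\<lambda>x. max 0 (x - \<gamma>))"
  proof -
    have "0 \<le> measure_pmf.expectation F (\<lambda>x. max 0 (x - \<gamma>))" by (intro integral_nonneg_AE) auto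
    moreover have "1 \<le> 1 / (1 - \<alpha>)" using \<alpha> by simp
    ultimately show ?thesis using mult_right_mono by fastforce
  qed
  finally show ?thesis by simp
qed

lemma expectation_le_CVaR: "measure_pmf.expectation F (\<lambda>x. x) \<le> CVaR \<alpha> F"
  unfolding CVaR_def by (rule cINF_greatest[OF _ expectation_le_CVaR_objective]) simp

lemma CVaR_le:
  "CVaR \<alpha> F \<le> \<gamma> + 1 / (1 - \<alpha>) * measure_pmf.expectation F (\<lambda>x. max 0 (x - \<gamma>))"
  unfolding CVaR_def
  by (rule cINF_lower[OF bdd_belowI2[OF expectation_le_CVaR_objective]]) simp

lemma CVaR_le_expectation:
  assumes "\<And>x. x \<in> set_pmf F \<Longrightarrow> 0 \<le> x"
  shows "CVaR \<alpha> F \<le> 1 / (1 - \<alpha>) * measure_pmf.expectation F (\<lambda>x. x)"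
proof -
  have "measure_pmf.expectation F (\<lambda>x. max 0 (x - 0)) = measure_pmf.expectation F (\<lambda>x. x)"
    using assms by (intro integral_cong_AE) (auto simp: AE_measure_pmf_iff)
  then show ?thesis using CVaR_le[of 0] by simp
qed

lemma CVaR_le_upper_bound:
  assumes "\<And>x. x \<in> set_pmf F \<Longrightarrow> x \<le> c"
  shows "CVaR \<alpha> F \<le> c"
proof -
  have "measure_pmf.expectation F (\<lambda>x. max 0 (x - c)) = measure_pmf.expectation F (\<lambda>x. 0)"
    using assms by (intro integral_cong_AE) (auto simp: AE_measure_pmf_iff)
  then show ?thesis using CVaR_le[of c] by simp
qed

end

definition expected_cost ::
  "(sched_instance \<Rightarrow> nat list \<Rightarrow> rat list \<Rightarrow> real) \<Rightarrow> sched_instance \<Rightarrow> nat list \<Rightarrow> real"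
where
  "expected_cost f I \<pi> = (\<Sum>(p, d)\<leftarrow>scenarios I. of_rat p * f I \<pi> d)"

text \<open>No scenario contributes negatively, so one of cost \<open>x\<close> contributes at least
  \<open>Pr_min I * x\<close> to the expectation; hence every outcome is at most
  \<open>?E / Pr_min I\<close>. Optimality enters only by making \<open>?E\<close> a lower bound on
  the CVaR of every schedule.\<close>

lemma CVaR_ratio_of_expected_cost_minimizer:
  assumes I: "I \<in> sched_instances" and \<alpha>: "0 \<le> \<alpha>" "\<alpha> < 1"
    and nonneg: "\<And>\<pi> p d. (p, d) \<in> set (scenarios I) \<Longrightarrow> 0 \<le> f I \<pi> d"
    and opt: "\<And>\<pi>'. \<pi>' \<in> schedules I \<Longrightarrow> expected_cost f I \<pi> \<le> expected_cost f I \<pi>'"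
  shows "CVaR \<alpha> (random_cost f I \<pi>) \<le>
    min (1 / Pr_min I) (1 / (1 - \<alpha>)) * (INF \<pi>'\<in>schedules I. CVaR \<alpha> (random_cost f I \<pi>'))"
proof -
  note wf = pmf_of_list_wf_random_cost[OF I, of f]
  have pos: "0 < p" if "(p, d) \<in> set (scenarios I)" for p d
    using I that unfolding sched_instances_def by blast
  have ne: "scenarios I \<noteq> []" using I unfolding sched_instances_def by auto
  have supp: "set_pmf (random_cost f I \<pi>) \<subseteq> (\<lambda>(p, d). f I \<pi> d) ` set (scenarios I)" for \<pi>
    using set_pmf_of_list[OF wf[of \<pi>]] by (force simp: random_cost_def)
  then have fin: "finite (set_pmf (random_cost f I \<pi>))" for \<pi>
    using finite_subset by blast
  have E: "measure_pmf.expectation (random_cost f I \<pi>) (\<lambda>x. x) = expected_cost f I \<pi>" for \<pi>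
    unfolding random_cost_def expectation_pmf_of_list[OF wf] expected_cost_def
    by (simp add: comp_def case_prod_unfold)
  let ?E = "expected_cost f I \<pi>" and ?inf = "INF \<pi>'\<in>schedules I. CVaR \<alpha> (random_cost f I \<pi>')"
  have term_le: "of_rat p * f I \<pi> d \<le> ?E" if "(p, d) \<in> set (scenarios I)" for p d
  proof -
    have "(\<lambda>(p, d). of_rat p * f I \<pi> d) (p, d) \<le> (\<Sum>x\<leftarrow>scenarios I. (\<lambda>(p, d). of_rat p * f I \<pi> d) x)"
      using that pos nonneg by (intro member_le_sum_list) (auto intro!: mult_nonneg_nonneg simp: less_imp_le)
    then show ?thesis by (simp add: expected_cost_def)
  qed
  let ?P = "(\<lambda>(p, d). of_rat p) ` set (scenarios I) :: real set"
  have "Pr_min I \<in> ?P" unfolding Pr_min_def using ne by (intro Min_in) auto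
  then have Pr_pos: "0 < Pr_min I" using pos by auto
  have Pr_le: "Pr_min I \<le> of_rat p" if "(p, d) \<in> set (scenarios I)" for p d
    unfolding Pr_min_def using that by (intro Min_le) force+
  have "CVaR \<alpha> (random_cost f I \<pi>) \<le> ?E / Pr_min I"
  proof (rule CVaR_le_upper_bound[OF fin \<alpha>])
    fix x assume "x \<in> set_pmf (random_cost f I \<pi>)"
    then obtain p d where pd: "(p, d) \<in> set (scenarios I)" "x = f I \<pi> d" using supp by fastforce
    have "x * Pr_min I \<le> x * of_rat p" using Pr_le[OF pd(1)] nonneg[OF pd(1)] pd(2) by (intro mult_left_mono) auto
    also have "\<dots> \<le> ?E" using term_le[OF pd(1)] pd(2) by (simp add: mult.commute)
    finally show "x \<le> ?E / Pr_min I" using Pr_pos by (simp add: field_simps)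
  qed
  moreover have "CVaR \<alpha> (random_cost f I \<pi>) \<le> 1 / (1 - \<alpha>) * ?E"
    unfolding E[symmetric] by (rule CVaR_le_expectation[OF fin \<alpha>]) (use supp nonneg in fastforce)
  ultimately have "CVaR \<alpha> (random_cost f I \<pi>) \<le> min (1 / Pr_min I) (1 / (1 - \<alpha>)) * ?E"
    by (simp add: min_def)
  also have "\<dots> \<le> min (1 / Pr_min I) (1 / (1 - \<alpha>)) * ?inf"
  proof (rule mult_left_mono)
    show "?E \<le> ?inf"
    proof (rule cINF_greatest)
      show "schedules I \<noteq> {}" by (simp add: schedules_def)
      show "?E \<le> CVaR \<alpha> (random_cost f I \<pi>')" if "\<pi>' \<in> schedules I" for \<pi>'
        using opt[OF that] expectation_le_CVaR[OF fin \<alpha>, of \<pi>'] E[of \<pi>'] by simp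
    qed
    show "0 \<le> min (1 / Pr_min I) (1 / (1 - \<alpha>))" using Pr_pos \<alpha> by simp
  qed
  finally show ?thesis .
qed

section \<open>The Hungarian method\<close>

text \<open>The reduced cost of placing job \<open>j\<close> at position \<open>t\<close>;
  \<open>u\<close> prices the jobs and \<open>v\<close> the positions.\<close>

definition slack :: "int list list \<Rightarrow> int list \<Rightarrow> int list \<Rightarrow> nat \<Rightarrow> nat \<Rightarrow> int" where
  "slack C u v j t = C ! j ! t - u ! j - v ! t"

section \<open>Dual updates and the search for a minimum slack\<close>

primrec add_all :: "int \<Rightarrow> (nat \<times> int list) list \<Rightarrow> int list \<Rightarrow> int list" where
  "add_all \<delta> [] u = u"
| "add_all \<delta> (e # R) u = add_all \<delta> R (u[fst e := u ! fst e + \<delta>])"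

text \<open>The accumulator holds the best slack so far, its position and its tree entry. Since the
  entry contains a matching, the winner can be extended without any lookup.\<close>

primrec scan_cols ::
  "(nat \<Rightarrow> nat \<Rightarrow> int) \<Rightarrow> nat \<times> int list \<Rightarrow> nat list \<Rightarrow> int \<times> nat \<times> nat \<times> int list \<Rightarrow> int \<times> nat \<times> nat \<times> int list"
where
  "scan_cols s e [] b = b"
| "scan_cols s e (t # ts) b =
    scan_cols s e ts (if s (fst e) t < fst b then (s (fst e) t, t, e) else b)"

primrec scan_rows ::
  "(nat \<Rightarrow> nat \<Rightarrow> int) \<Rightarrow> (nat \<times> int list) list \<Rightarrow> nat list \<Rightarrow> int \<times> nat \<times> nat \<times> int list \<Rightarrow> int \<times> nat \<times> nat \<times> int list"
where
  "scan_rows s [] ts b = b"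
| "scan_rows s (e # R) ts b = scan_rows s R ts (scan_cols s e ts b)"

lemma length_add_all [simp]: "length (add_all \<delta> R u) = length u"
  by (induction R arbitrary: u) auto

text \<open>Distinctness ensures that no index is increased twice. It will be applied to the tree
  jobs and to the reached positions.\<close>

lemma add_all_nth:
  assumes "distinct (map fst R)" "i < length u"
  shows "add_all \<delta> R u ! i = u ! i + (if i \<in> fst ` set R then \<delta> else 0)"
  using assms
proof (induction R arbitrary: u)
  case (Cons e R)
  then have "add_all \<delta> (e # R) u ! i =
      u[fst e := u ! fst e + \<delta>] ! i + (if i \<in> fst ` set R then \<delta> else 0)"
    by simp
  with Cons.prems show ?case by (cases "i = fst e") auto
qed simp

text \<open>What a scan can return besides its initial accumulator. If the initial value is itself a
  candidate, membership here and the bounds \<open>scan_cols_le\<close> and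
  \<open>scan_rows_le\<close> say that the scan attains the minimum.\<close>

definition candidates :: "(nat \<Rightarrow> nat \<Rightarrow> int) \<Rightarrow> (nat \<times> int list) set \<Rightarrow> nat set \<Rightarrow> (int \<times> nat \<times> nat \<times> int list) set" where
  "candidates s R ts = (\<lambda>(e, t). (s (fst e) t, t, e)) ` (R \<times> ts)"

lemma scan_cols_in: "scan_cols s e ts b \<in> insert b (candidates s {e} (set ts))"
proof (induction ts arbitrary: b)
  case (Cons t ts)
  let ?b = "if s (fst e) t < fst b then (s (fst e) t, t, e) else b"
  have "?b \<in> insert b (candidates s {e} (set (t # ts)))" by (auto simp: candidates_def)
  moreover have "candidates s {e} (set ts) \<subseteq> candidates s {e} (set (t # ts))"
    by (auto simp: candidates_def)
  moreover have "scan_cols s e (t # ts) b \<in> insert ?b (candidates s {e} (set ts))"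
    using Cons.IH[of ?b] by simp
  moreover have "x \<in> insert b B" if "b' \<in> insert b B" "A \<subseteq> B" "x \<in> insert b' A"
    for x b' and A B :: "(int \<times> nat \<times> nat \<times> int list) set"
    using that by blast
  ultimately show ?case by presburger
qed simp

lemma scan_cols_le:
  "fst (scan_cols s e ts b) \<le> fst b \<and> (\<forall>t\<in>set ts. fst (scan_cols s e ts b) \<le> s (fst e) t)"
proof (induction ts arbitrary: b)
  case (Cons t ts)
  let ?b = "if s (fst e) t < fst b then (s (fst e) t, t, e) else b"
  have "fst ?b \<le> fst b" "fst ?b \<le> s (fst e) t" by auto
  with Cons.IH[of ?b] show ?case by fastforce
qed auto

lemma scan_rows_in: "scan_rows s R ts b \<in> insert b (candidates s (set R) (set ts))"
proof (induction R arbitrary: b)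
  case (Cons e R)
  have "scan_rows s (e # R) ts b \<in> insert (scan_cols s e ts b) (candidates s (set R) (set ts))"
    using Cons.IH by simp
  also have "\<dots> \<subseteq> insert b (candidates s (set (e # R)) (set ts))"
  proof -
    have "candidates s {e} (set ts) \<subseteq> candidates s (set (e # R)) (set ts)"
      "candidates s (set R) (set ts) \<subseteq> candidates s (set (e # R)) (set ts)"
      by (auto simp: candidates_def)
    then show ?thesis using scan_cols_in[of s e ts b] by blast
  qed
  finally show ?case .
qed auto

lemma scan_rows_le:
  "fst (scan_rows s R ts b) \<le> fst b \<and> (\<forall>e\<in>set R. \<forall>t\<in>set ts. fst (scan_rows s R ts b) \<le> s (fst e) t)"
proof (induction R arbitrary: b)
  case (Cons e R)
  show ?case using Cons.IH[of "scan_cols s e ts b"] scan_cols_le[of s e ts b] by fastforce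
qed auto

text \<open>
  A partial matching is a list indexed by the positions: its entry is the job placed there, or
  negative if the position is free.
\<close>

definition jobs :: "int list \<Rightarrow> int multiset" where
  "jobs m = filter_mset (\<lambda>x. 0 \<le> x) (mset m)"

text \<open>Feasibility for the dual of the linear assignment problem, where the dual variables are
  free in sign.\<close>

definition feasible :: "nat \<Rightarrow> int list list \<Rightarrow> int list \<Rightarrow> int list \<Rightarrow> bool" where
  "feasible n C u v \<longleftrightarrow> (\<forall>j<n. \<forall>t<n. u ! j + v ! t \<le> C ! j ! t)"

text \<open>Complementary slackness: the matched pairs have reduced cost 0.\<close>

definition tight_duals :: "nat \<Rightarrow> int list list \<Rightarrow> int list \<Rightarrow> int list \<Rightarrow> int list \<Rightarrow> bool" where
  "tight_duals n C u v m \<longleftrightarrow> (\<forall>t<n. 0 \<le> m ! t \<longrightarrow> u ! nat (m ! t) + v ! t = C ! nat (m ! t) ! t)"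

text \<open>The multiset equation records at once that exactly the jobs below \<open>k\<close> are
  placed and that none is placed twice.\<close>

definition stage_inv :: "nat \<Rightarrow> int list list \<Rightarrow> nat \<Rightarrow> int list \<Rightarrow> int list \<Rightarrow> int list \<Rightarrow> bool" where
  "stage_inv n C k u v m \<longleftrightarrow>
     length u = n \<and> length v = n \<and> length m = n \<and> feasible n C u v \<and> tight_duals n C u v m \<and>
     jobs m = image_mset int (mset_set {..<k})"

text \<open>
  Job \<open>k\<close> is being inserted into the matching \<open>m\<close>. The tree consists of the pairs \<open>(j, mj)\<close> in \<open>R\<close>: the
  matching \<open>mj\<close> arises from \<open>m\<close> by placing job \<open>k\<close> and shifting jobs along an alternating path, at the
  end of which job \<open>j\<close> has lost its position. The positions not yet reached are \<open>ts\<close>, those in the tree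
  are the first components of \<open>Z\<close>; the second components of \<open>Z\<close> are irrelevant and only make
  \<open>add_all\<close> applicable to both dual vectors. Storing whole matchings spares the bookkeeping of paths.
\<close>

definition tree_inv ::
  "nat \<Rightarrow> int list list \<Rightarrow> nat \<Rightarrow> int list \<Rightarrow> int list \<Rightarrow> int list \<Rightarrow>
   (nat \<times> int list) list \<Rightarrow> (nat \<times> int list) list \<Rightarrow> nat list \<Rightarrow> bool"
where
  "tree_inv n C k m u v R Z ts \<longleftrightarrow>
     length u = n \<and> length v = n \<and> length m = n \<and> k < n \<and> feasible n C u v \<and>
     jobs m = image_mset int (mset_set {..<k}) \<and>
     distinct (map fst R) \<and> distinct (map fst Z) \<and>
     fst ` set Z = {..<n} - set ts \<and> set ts \<subseteq> {..<n} \<and>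
     (\<exists>t\<in>set ts. m ! t < 0) \<and> R \<noteq> [] \<and>
     (\<forall>(j, mj)\<in>set R. j < n \<and> length mj = n \<and> jobs mj + {#int j#} = jobs m + {#int k#} \<and>
        tight_duals n C u v mj \<and> (\<forall>t\<in>set ts. mj ! t = m ! t) \<and>
        (\<forall>t<n. t \<notin> set ts \<longrightarrow> 0 \<le> mj ! t \<longrightarrow> nat (mj ! t) \<in> fst ` set R)) \<and>
     (\<forall>t\<in>set ts. 0 \<le> m ! t \<longrightarrow> nat (m ! t) \<notin> fst ` set R)"

text \<open>Stated with additions on both sides to avoid multiset subtraction; the job displaced
  from \<open>t\<close> appears only if \<open>t\<close> was occupied.\<close>

lemma jobs_update:
  assumes "t < length m" "0 \<le> x"
  shows "jobs (m[t := x]) + (if 0 \<le> m ! t then {#m ! t#} else {#}) = jobs m + {#x#}"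
proof -
  have "m ! t \<in># mset m" using assms by simp
  then obtain A where A: "mset m = add_mset (m ! t) A" by (blast dest: multi_member_split)
  then have "mset (m[t := x]) = add_mset x A" using assms by (simp add: mset_update)
  then show ?thesis using A assms unfolding jobs_def by simp
qed

lemma jobs_nth:
  assumes "t < length m" "0 \<le> m ! t"
  shows "m ! t \<in># jobs m"
  using assms unfolding jobs_def by simp

text \<open>If a job stood at two positions, freeing one of them would leave it in the matching, so
  its multiplicity would be at least 2, whereas every job below \<open>k\<close> has multiplicity
  1.\<close>

lemma jobs_inj:
  assumes "jobs m = image_mset int (mset_set {..<k})" "s < length m" "t < length m"
    "m ! s = m ! t" "0 \<le> m ! t"
  shows "s = t"
proof (rule ccontr)
  assume "s \<noteq> t"
  then have "m ! t \<in># jobs (m[s := 0 - 1])"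
    using assms jobs_nth[of t "m[s := 0 - 1]"] by simp
  moreover have "jobs m = jobs (m[s := 0 - 1]) + {#m ! t#}"
  proof -
    have "m ! s \<in># mset m" using assms by simp
    then obtain A where A: "mset m = add_mset (m ! s) A" by (blast dest: multi_member_split)
    then have "mset (m[s := 0 - 1]) = add_mset (0 - 1) A" using assms by (simp add: mset_update)
    then show ?thesis using A assms unfolding jobs_def by simp
  qed
  ultimately have "2 \<le> count (jobs m) (m ! t)"
    by (simp add: Suc_le_eq)
  moreover have "count (jobs m) (m ! t) \<le> 1"
    unfolding assms(1) by (subst image_mset_mset_set) (auto simp: count_mset_set')
  ultimately show False by simp
qed

lemma image_int_Suc:
  "image_mset int (mset_set {..<Suc k}) = image_mset int (mset_set {..<k}) + {#int k#}"
  by (simp add: lessThan_Suc)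

text \<open>The root is the unplaced job \<open>k\<close> with the unchanged matching. A free
  position exists by counting: only \<open>k < n\<close> of the \<open>n\<close> positions are
  occupied.\<close>

lemma tree_inv_init:
  assumes "stage_inv n C k u v m" "k < n"
  shows "tree_inv n C k m u v [(k, m)] [] [0..<n]"
proof -
  have "\<exists>t<n. m ! t < 0"
  proof (rule ccontr)
    assume "\<not> ?thesis"
    then have "0 \<le> m ! t" if "t < n" for t using that by force
    then have "\<forall>x\<in>set m. 0 \<le> x" using assms by (auto simp: in_set_conv_nth stage_inv_def)
    then have "jobs m = mset m" unfolding jobs_def by (simp add: filter_mset_eq_conv)
    then have "size (jobs m) = n" using assms unfolding stage_inv_def by (metis size_mset)
    moreover have "size (jobs m) = k" using assms by (simp add: stage_inv_def)
    ultimately show False using assms by simp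
  qed
  moreover have "nat (m ! t) \<noteq> k" if "t < n" "0 \<le> m ! t" for t
  proof -
    have "m ! t \<in># jobs m" using that assms by (intro jobs_nth) (auto simp: stage_inv_def)
    then show ?thesis using assms by (auto simp: stage_inv_def)
  qed
  ultimately show ?thesis using assms unfolding tree_inv_def stage_inv_def by auto
qed

text \<open>The prices of tree jobs rise by \<open>\<delta>\<close> and those of reached positions
  fall by \<open>\<delta>\<close>. Slacks between tree jobs and unreached positions drop by
  \<open>\<delta>\<close>, which minimality permits, and the pair \<open>(j, t)\<close> becomes
  tight. So \<open>j\<close>, which \<open>mj\<close> leaves unplaced, can take \<open>t\<close>: if
  \<open>t\<close> is free the stage is complete, otherwise the occupant of \<open>t\<close> is the
  next displaced job and joins the tree.\<close>

lemma tree_step: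
  fixes j t :: nat
  assumes inv: "tree_inv n C k m u v R Z ts"
    and e: "(j, mj) \<in> set R" and t: "t \<in> set ts"
    and min: "\<forall>e\<in>set R. \<forall>t'\<in>set ts. slack C u v j t \<le> slack C u v (fst e) t'"
  defines "\<delta> \<equiv> slack C u v j t"
  defines "u' \<equiv> add_all \<delta> R u" and "v' \<equiv> add_all (0 - \<delta>) Z v" and "m' \<equiv> mj[t := int j]"
  shows "m ! t < 0 \<Longrightarrow> stage_inv n C (Suc k) u' v' m'"
    and "\<not> m ! t < 0 \<Longrightarrow>
      tree_inv n C k m u' v' ((nat (m ! t), m') # R) ((t, m') # Z) (filter (\<lambda>a. a \<noteq> t) ts)"
proof -
  have len: "length u = n" "length v = n" "length m = n" "k < n"
    and feas0: "feasible n C u v" and jm: "jobs m = image_mset int (mset_set {..<k})"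
    and dR: "distinct (map fst R)" and dZ: "distinct (map fst Z)"
    and Z: "fst ` set Z = {..<n} - set ts" and tsn: "set ts \<subseteq> {..<n}"
    and free_ex: "\<exists>t\<in>set ts. m ! t < 0" and R_ne: "R \<noteq> []"
    and RD0: "\<forall>(j, mj)\<in>set R. j < n \<and> length mj = n \<and> jobs mj + {#int j#} = jobs m + {#int k#} \<and>
        tight_duals n C u v mj \<and> (\<forall>t\<in>set ts. mj ! t = m ! t) \<and>
        (\<forall>t<n. t \<notin> set ts \<longrightarrow> 0 \<le> mj ! t \<longrightarrow> nat (mj ! t) \<in> fst ` set R)"
    and out0: "\<forall>t\<in>set ts. 0 \<le> m ! t \<longrightarrow> nat (m ! t) \<notin> fst ` set R"
    using inv unfolding tree_inv_def by - (elim conjE, assumption)+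
  have RD: "j < n" "length mj = n" "jobs mj + {#int j#} = jobs m + {#int k#}"
      "tight_duals n C u v mj" "\<And>t. t \<in> set ts \<Longrightarrow> mj ! t = m ! t"
      "\<And>t. t < n \<Longrightarrow> t \<notin> set ts \<Longrightarrow> 0 \<le> mj ! t \<Longrightarrow> nat (mj ! t) \<in> fst ` set R"
      if "(j, mj) \<in> set R" for j mj
    using bspec[OF RD0 that] by simp_all
  have tn: "t < n" using t tsn by auto
  have out: "nat (m ! t) \<notin> fst ` set R" if "t \<in> set ts" "0 \<le> m ! t" for t using out0 that by blast
  have u': "u' ! i = u ! i + (if i \<in> fst ` set R then \<delta> else 0)" if "i < n" for i
    unfolding u'_def using add_all_nth[of R i u] dR len that by simp
  have v': "v' ! i = v ! i - (if i \<in> set ts then 0 else \<delta>)" if "i < n" for i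
  proof -
    have "i \<in> fst ` set Z \<longleftrightarrow> i \<notin> set ts" using Z that by simp
    moreover have "v' ! i = v ! i + (if i \<in> fst ` set Z then 0 - \<delta> else 0)"
      unfolding v'_def using add_all_nth[of Z i v] dZ len that by simp
    ultimately show ?thesis by auto
  qed
  have len': "length u' = n" "length v' = n" "length m' = n"
    using len RD[OF e] by (auto simp: u'_def v'_def m'_def)
  have jR: "j \<in> fst ` set R" using e by force
  \<comment> \<open>Needed for jobs outside the tree at reached positions: their slack grows by
    \<open>\<delta>\<close>.\<close>
  have d0: "0 \<le> \<delta>" using feas0 RD(1)[OF e] tn unfolding \<delta>_def slack_def feasible_def by (metis add.commute diff_ge_0_iff_ge le_diff_eq)
  have feas: "feasible n C u' v'"
    unfolding feasible_def
  proof (intro allI impI)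
    fix i s assume lt: "i < n" "s < n"
    have old: "u ! i + v ! s \<le> C ! i ! s" using feas0 lt unfolding feasible_def by blast
    show "u' ! i + v' ! s \<le> C ! i ! s"
    proof (cases "i \<in> fst ` set R \<and> s \<in> set ts")
      case True
      then have "\<delta> \<le> slack C u v i s" using min unfolding \<delta>_def by force
      then show ?thesis using True u'[OF lt(1)] v'[OF lt(2)] by (simp add: slack_def)
    next
      case False
      then show ?thesis using old d0 u'[OF lt(1)] v'[OF lt(2)] by auto
    qed
  qed
  have jobs_lt: "nat x < n" if "(i, mi) \<in> set R" "x \<in># jobs mi" for i mi x
  proof -
    have "x \<in># jobs m + {#int k#}" using RD(3)[OF that(1)] that(2) by (metis union_iff)
    then show ?thesis using jm len by auto
  qed
  have tight': "tight_duals n C u' v' mi" if "(i, mi) \<in> set R" for i mi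
    unfolding tight_duals_def
  proof (intro allI impI)
    fix s assume s: "s < n" "0 \<le> mi ! s"
    have lt: "nat (mi ! s) < n"
      by (rule jobs_lt[OF that jobs_nth]) (use s RD(2)[OF that] in auto)
    have old: "u ! nat (mi ! s) + v ! s = C ! nat (mi ! s) ! s"
      using RD(4)[OF that] s unfolding tight_duals_def by blast
    \<comment> \<open>A matched job lies in the tree exactly when its position has been reached, so
      the changes of its two prices cancel or are both absent.\<close>
    have "nat (mi ! s) \<in> fst ` set R \<longleftrightarrow> s \<notin> set ts"
      using out[of s] RD(5)[OF that, of s] RD(6)[OF that, of s] s by metis
    then show "u' ! nat (mi ! s) + v' ! s = C ! nat (mi ! s) ! s"
      using old u'[OF lt] v'[OF s(1)] by auto
  qed
  have tm': "tight_duals n C u' v' m'"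
    unfolding tight_duals_def
  proof (intro allI impI)
    fix s assume s: "s < n" "0 \<le> m' ! s"
    show "u' ! nat (m' ! s) + v' ! s = C ! nat (m' ! s) ! s"
    proof (cases "s = t")
      case True
      then show ?thesis using u'[OF RD(1)[OF e]] v'[OF tn] jR t RD(2)[OF e] tn
        by (simp add: m'_def \<delta>_def slack_def)
    next
      case False
      then show ?thesis using tight'[OF e] s unfolding m'_def tight_duals_def by auto
    qed
  qed
  \<comment> \<open>Alternating paths alter reached positions only, so \<open>t\<close> still has
    its occupant from \<open>m\<close>.\<close>
  have mjt: "mj ! t = m ! t" using RD(5)[OF e] t by blast
  have jm': "jobs m' + (if 0 \<le> m ! t then {#m ! t#} else {#}) = jobs m + {#int k#}"
    using jobs_update[of t mj "int j", unfolded mjt] RD(2,3)[OF e] tn unfolding m'_def by simp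
  show "stage_inv n C (Suc k) u' v' m'" if "m ! t < 0"
    unfolding stage_inv_def image_int_Suc using len' feas tm' jm' that jm by auto
  show "tree_inv n C k m u' v' ((nat (m ! t), m') # R) ((t, m') # Z) (filter (\<lambda>a. a \<noteq> t) ts)"
    if free: "\<not> m ! t < 0"
  proof -
    let ?R = "(nat (m ! t), m') # R" and ?ts = "filter (\<lambda>a. a \<noteq> t) ts"
    have nm: "nat (m ! t) < n"
      using jobs_lt[OF e jobs_nth[of t mj]] RD(2)[OF e] tn mjt free by simp
    have A: "distinct (map fst ?R)" using dR out[OF t] free by auto
    have B: "distinct (map fst ((t, m') # Z))" "fst ` set ((t, m') # Z) = {..<n} - set ?ts"
      using dZ Z t tn by auto
    have D: "\<exists>t\<in>set ?ts. m ! t < 0" using free_ex free by auto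
    have E: "jobs m' + {#int (nat (m ! t))#} = jobs m + {#int k#}" using jm' free by simp
    have F: "m' ! s = m ! s" if "s \<in> set ?ts" for s using that RD(5)[OF e] by (auto simp: m'_def)
    have G: "nat (m' ! s) \<in> fst ` set ?R" if "s < n" "s \<notin> set ?ts" "0 \<le> m' ! s" for s
    proof (cases "s = t")
      case True
      then show ?thesis using jR RD(2)[OF e] tn by (simp add: m'_def)
    next
      case False
      then have "nat (mj ! s) \<in> fst ` set R" using RD(6)[OF e, of s] that by (auto simp: m'_def)
      then show ?thesis using False by (simp add: m'_def)
    qed
    have H: "i < n \<and> length mi = n \<and> jobs mi + {#int i#} = jobs m + {#int k#} \<and>
        tight_duals n C u' v' mi \<and> (\<forall>t\<in>set ?ts. mi ! t = m ! t) \<and>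
        (\<forall>t<n. t \<notin> set ?ts \<longrightarrow> 0 \<le> mi ! t \<longrightarrow> nat (mi ! t) \<in> fst ` set ?R)"
      if imi: "(i, mi) \<in> set ?R" for i mi
    proof (cases "(i, mi) = (nat (m ! t), m')")
      case True
      then show ?thesis using nm len' E tm' F G by auto
    next
      case False
      then have R: "(i, mi) \<in> set R" using imi by auto
      have "nat (mi ! s) \<in> fst ` set ?R" if "s < n" "s \<notin> set ?ts" "0 \<le> mi ! s" for s
        using that RD(5)[OF R t] RD(6)[OF R, of s] by (cases "s = t") auto
      then show ?thesis using RD[OF R] tight'[OF R] by auto
    qed
    have K: "nat (m ! s) \<notin> fst ` set ?R" if "s \<in> set ?ts" "0 \<le> m ! s" for s
    proof -
      \<comment> \<open>A job is placed at most once, so the occupants of the remaining unreached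
        positions differ from the job that has just joined the tree.\<close>
      have "m ! s \<noteq> m ! t"
        using jobs_inj[of m k s t] jm len that tn tsn free by auto
      then show ?thesis using out[of s] that free by auto
    qed
    show ?thesis unfolding tree_inv_def

      using len len' feas jm A B D
    proof (intro conjI)
      show "set ?ts \<subseteq> {..<n}" using tsn by auto
      show "\<forall>(j, mj)\<in>set ?R. j < n \<and> length mj = n \<and> jobs mj + {#int j#} = jobs m + {#int k#} \<and>
          tight_duals n C u' v' mj \<and> (\<forall>t\<in>set ?ts. mj ! t = m ! t) \<and>
          (\<forall>t<n. t \<notin> set ?ts \<longrightarrow> 0 \<le> mj ! t \<longrightarrow> nat (mj ! t) \<in> fst ` set ?R)"
        using H by blast
      show "\<forall>t\<in>set ?ts. 0 \<le> m ! t \<longrightarrow> nat (m ! t) \<notin> fst ` set ?R" using K by blast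
    qed simp_all
  qed
qed

text \<open>The \<open>n\<close> entries of \<open>m\<close> contain \<open>n\<close> nonnegative
  ones, so no position is free and \<open>m\<close> is a permutation.\<close>

lemma stage_inv_schedule:
  assumes "stage_inv n C n u v m"
  obtains \<pi> where "m = map int \<pi>" "\<pi> \<in> permutations_of_set {..<n}"
proof -
  have len: "length m = n" and jm: "jobs m = image_mset int (mset_set {..<n})"
    using assms by (auto simp: stage_inv_def)
  have "size (jobs m) = size (mset m)" using jm len by simp
  moreover have "jobs m \<subseteq># mset m" unfolding jobs_def by simp
  ultimately have "jobs m = mset m" by (metis mset_subset_size order_less_irrefl subset_mset.less_le)
  with jm have mm: "mset m = image_mset int (mset_set {..<n})" by simp
  define \<pi> where "\<pi> = map nat m"
  have "set m = int ` {..<n}" using arg_cong[OF mm, of set_mset] by simp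
  then have "m = map int \<pi>" unfolding \<pi>_def by (auto intro!: map_idI[symmetric])
  moreover have "mset \<pi> = mset_set {..<n}"
    unfolding \<pi>_def mset_map mm by (simp add: image_mset.compositionality comp_def)
  then have "\<pi> \<in> permutations_of_set {..<n}"
    by (metis finite_lessThan finite_set_mset_mset_set mset_eq_mset_set_imp_distinct permutations_of_setI set_mset_mset)
  ultimately show ?thesis using that by blast
qed

lemma sum_permutation:
  fixes g :: "nat \<Rightarrow> 'a :: comm_monoid_add"
  assumes "\<pi> \<in> permutations_of_set {..<n}"
  shows "(\<Sum>t<n. g (\<pi> ! t)) = (\<Sum>j<n. g j)"
proof -
  have "distinct \<pi>" "set \<pi> = {..<n}" using assms by (auto dest: permutations_of_setD)
  moreover have "length \<pi> = n" using assms by (simp add: length_finite_permutations_of_set)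
  ultimately have "bij_betw ((!) \<pi>) {..<n} {..<n}" using bij_betw_nth by blast
  then show ?thesis by (rule sum.reindex_bij_betw)
qed

text \<open>Weak duality: the sum of all dual variables is the same for every permutation. It bounds
  every cost from below by feasibility and equals the cost of \<open>\<pi>\<close> by
  tightness.\<close>

lemma stage_inv_optimal:
  assumes "stage_inv n C n u v (map int \<pi>)" "\<pi> \<in> permutations_of_set {..<n}"
    "\<pi>' \<in> permutations_of_set {..<n}"
  shows "(\<Sum>t<n. C ! (\<pi> ! t) ! t) \<le> (\<Sum>t<n. C ! (\<pi>' ! t) ! t)"
proof -
  have len: "length \<pi> = n" "length \<pi>' = n" using assms by (simp_all add: length_finite_permutations_of_set)
  have lt: "\<pi>' ! t < n" if "t < n" for t
    using that len nth_mem[of t \<pi>'] permutations_of_setD(1)[OF assms(3)] by auto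
  have "(\<Sum>t<n. C ! (\<pi> ! t) ! t) = (\<Sum>t<n. u ! (\<pi> ! t) + v ! t)"
    using assms(1) len by (intro sum.cong) (auto simp: stage_inv_def tight_duals_def)
  also have "\<dots> = (\<Sum>t<n. u ! (\<pi>' ! t) + v ! t)"
    using sum_permutation[OF assms(2), of "(!) u"] sum_permutation[OF assms(3), of "(!) u"]
    by (simp add: sum.distrib)
  also have "\<dots> \<le> (\<Sum>t<n. C ! (\<pi>' ! t) ! t)"
    using assms(1) lt by (intro sum_mono) (auto simp: stage_inv_def feasible_def)
  finally show ?thesis .
qed

section \<open>The program\<close>

text \<open>
  The rules for \<open>evaluates_within\<close> are directed by the syntax of the expression, so that repeated resolution runs a
  function body symbolically and assembles its value and a bound on its running time.
\<close>

definition evaluates_within :: "program \<Rightarrow> val list \<Rightarrow> expr \<Rightarrow> val \<Rightarrow> nat \<Rightarrow> bool" where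
  "evaluates_within P \<Gamma> e v T \<longleftrightarrow> (\<exists>t\<le>T. evaluates P \<Gamma> e v t)"

abbreviation encl :: "('a \<Rightarrow> val) \<Rightarrow> 'a list \<Rightarrow> val" where
  "encl f xs \<equiv> enc_list (map f xs)"

abbreviation vnat :: "nat \<Rightarrow> val" where
  "vnat i \<equiv> VInt (int i)"

abbreviation vent :: "nat \<times> int list \<Rightarrow> val" where
  "vent e \<equiv> VCons (vnat (fst e)) (encl VInt (snd e))"

abbreviation vbest :: "int \<times> nat \<times> nat \<times> int list \<Rightarrow> val" where
  "vbest b \<equiv> VCons (VInt (fst b)) (VCons (vnat (fst (snd b))) (vent (snd (snd b))))"

abbreviation vduals :: "int list list \<Rightarrow> int list \<Rightarrow> int list \<Rightarrow> val" where
  "vduals C u v \<equiv> VCons (encl (encl VInt) C) (VCons (encl VInt u) (encl VInt v))"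

text \<open>The language has no projections, so pairs are taken apart by a case distinction; the nil
  branch is a dummy.\<close>

definition efst :: "expr \<Rightarrow> expr" where "efst e = ECase e ENil (EVar 0)"
definition esnd :: "expr \<Rightarrow> expr" where "esnd e = ECase e ENil (EVar 1)"

section \<open>Rules for symbolic evaluation with a time bound\<close>

lemma within_mono: "evaluates_within P \<Gamma> e v s \<Longrightarrow> s \<le> t \<Longrightarrow> evaluates_within P \<Gamma> e v t"
  unfolding evaluates_within_def by (meson le_trans)

text \<open>Used at the start of a run: resolution fills in whatever value and time the rules
  produce, and two separate goals compare them with the claimed ones.\<close>

lemma within_conv: "evaluates_within P \<Gamma> e w s \<Longrightarrow> w = v \<Longrightarrow> s \<le> t \<Longrightarrow> evaluates_within P \<Gamma> e v t"
  using within_mono by blast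

text \<open>One rule per index lets plain resolution select the value. Index 6 is the largest in the
  program: it is the argument inside the six nested bindings of \<open>grow_body\<close>.\<close>

lemma within_var:
  "evaluates_within P (x0 # \<Gamma>) (EVar 0) x0 1"
  "evaluates_within P (x0 # x1 # \<Gamma>) (EVar 1) x1 1"
  "evaluates_within P (x0 # x1 # x2 # \<Gamma>) (EVar 2) x2 1"
  "evaluates_within P (x0 # x1 # x2 # x3 # \<Gamma>) (EVar 3) x3 1"
  "evaluates_within P (x0 # x1 # x2 # x3 # x4 # \<Gamma>) (EVar 4) x4 1"
  "evaluates_within P (x0 # x1 # x2 # x3 # x4 # x5 # \<Gamma>) (EVar 5) x5 1"
  "evaluates_within P (x0 # x1 # x2 # x3 # x4 # x5 # x6 # \<Gamma>) (EVar 6) x6 1"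
proof -
  have *: "i < length \<Gamma> \<Longrightarrow> \<Gamma> ! i = v \<Longrightarrow> evaluates_within P \<Gamma> (EVar i) v 1" for \<Gamma> i v
    unfolding evaluates_within_def using evaluates.Var by blast
  show "evaluates_within P (x0 # \<Gamma>) (EVar 0) x0 1"
    "evaluates_within P (x0 # x1 # \<Gamma>) (EVar 1) x1 1"
    "evaluates_within P (x0 # x1 # x2 # \<Gamma>) (EVar 2) x2 1"
    "evaluates_within P (x0 # x1 # x2 # x3 # \<Gamma>) (EVar 3) x3 1"
    "evaluates_within P (x0 # x1 # x2 # x3 # x4 # \<Gamma>) (EVar 4) x4 1"
    "evaluates_within P (x0 # x1 # x2 # x3 # x4 # x5 # \<Gamma>) (EVar 5) x5 1"
    "evaluates_within P (x0 # x1 # x2 # x3 # x4 # x5 # x6 # \<Gamma>) (EVar 6) x6 1"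
    by (rule *; simp)+
qed

lemma within_lit: "evaluates_within P \<Gamma> (ELit c) (VInt c) 1"
  unfolding evaluates_within_def using evaluates.Lit by blast

lemma within_nil: "evaluates_within P \<Gamma> ENil VNil 1"
  unfolding evaluates_within_def using evaluates.Nil by blast

lemma within_cons:
  "evaluates_within P \<Gamma> a u s \<Longrightarrow> evaluates_within P \<Gamma> b v t \<Longrightarrow> evaluates_within P \<Gamma> (ECons a b) (VCons u v) (1 + s + t)"
  unfolding evaluates_within_def by (meson evaluates.Cons add_mono le_refl)

lemma within_let:
  "evaluates_within P \<Gamma> a u s \<Longrightarrow> evaluates_within P (u # \<Gamma>) b v t \<Longrightarrow> evaluates_within P \<Gamma> (ELet a b) v (1 + s + t)"
  unfolding evaluates_within_def by (meson evaluates.Let add_mono le_refl)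

lemma within_case_nil:
  "evaluates_within P \<Gamma> e VNil s \<Longrightarrow> evaluates_within P \<Gamma> a v t \<Longrightarrow> evaluates_within P \<Gamma> (ECase e a b) v (1 + s + t)"
  unfolding evaluates_within_def by (meson evaluates.Case_Nil add_mono le_refl)

lemma within_case_cons:
  "evaluates_within P \<Gamma> e (VCons h l) s \<Longrightarrow> evaluates_within P (h # l # \<Gamma>) b v t \<Longrightarrow> evaluates_within P \<Gamma> (ECase e a b) v (1 + s + t)"
  unfolding evaluates_within_def by (meson evaluates.Case_Cons add_mono le_refl)

lemma within_fst: "evaluates_within P \<Gamma> e (VCons a b) s \<Longrightarrow> evaluates_within P \<Gamma> (efst e) a (s + 2)"
  unfolding efst_def using within_case_cons[OF _ within_var(1)] by fastforce

lemma within_snd: "evaluates_within P \<Gamma> e (VCons a b) s \<Longrightarrow> evaluates_within P \<Gamma> (esnd e) b (s + 2)"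
  unfolding esnd_def using within_case_cons[OF _ within_var(2)] by fastforce

text \<open>For values whose cons form is visible only after rewriting, such as
  \<open>enc_rat r\<close> or the encoding of a list known to be nonempty; the equation is then
  supplied as a rule.\<close>

lemma within_fst_eq: "evaluates_within P \<Gamma> e w s \<Longrightarrow> w = VCons a b \<Longrightarrow> evaluates_within P \<Gamma> (efst e) a (s + 2)"
  using within_fst by blast

lemma within_snd_eq: "evaluates_within P \<Gamma> e w s \<Longrightarrow> w = VCons a b \<Longrightarrow> evaluates_within P \<Gamma> (esnd e) b (s + 2)"
  using within_snd by blast

lemma within_call:
  assumes "evaluates_within P \<Gamma> a u s" "f < length P" "evaluates_within P [u] (P ! f) v t"
  shows "evaluates_within P \<Gamma> (ECall f a) v (1 + s + t)"
proof -
  obtain s' t' where "evaluates P \<Gamma> a u s'" "s' \<le> s" "evaluates P [u] (P ! f) v t'" "t' \<le> t"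
    using assms unfolding evaluates_within_def by blast
  then have "evaluates P \<Gamma> (ECall f a) v (1 + s' + t')" "1 + s' + t' \<le> 1 + s + t"
    using evaluates.Call assms(2) by (blast, simp)
  then show ?thesis unfolding evaluates_within_def by blast
qed

text \<open>These numbers are the positions of the bodies in the list \<open>prog\<close>.\<close>

abbreviation (input) "fMAIN \<equiv> 0 :: nat"
abbreviation (input) "fNTH \<equiv> 1 :: nat"
abbreviation (input) "fUPD \<equiv> 2 :: nat"
abbreviation (input) "fADDALL \<equiv> 3 :: nat"
abbreviation (input) "fREMOVE \<equiv> 4 :: nat"
abbreviation (input) "fSLACK \<equiv> 5 :: nat"
abbreviation (input) "fSCANC \<equiv> 6 :: nat"
abbreviation (input) "fSCANR \<equiv> 7 :: nat"
abbreviation (input) "fGROW \<equiv> 8 :: nat"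
abbreviation (input) "fSTAGES \<equiv> 9 :: nat"
abbreviation (input) "fDENS \<equiv> 10 :: nat"
abbreviation (input) "fALLDENS \<equiv> 11 :: nat"
abbreviation (input) "fENTRY \<equiv> 12 :: nat"
abbreviation (input) "fROW \<equiv> 13 :: nat"
abbreviation (input) "fMAT \<equiv> 14 :: nat"
abbreviation (input) "fUPTO \<equiv> 15 :: nat"
abbreviation (input) "fCONST \<equiv> 16 :: nat"
abbreviation (input) "fPEN \<equiv> 17 :: nat"

text \<open>Functions are unary, so arguments are right-nested tuples. In the second branch of the
  case distinction, indices 0 and 1 are head and tail, and the argument itself moves to index 2; the
  other bodies follow the same layout.\<close>

definition nth_body :: expr where
  "nth_body = ECase (efst (EVar 0)) ENil
     (EIf (EOp Less (esnd (EVar 2)) (ELit 1)) (EVar 0)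
       (ECall fNTH (ECons (EVar 1) (EOp Sub (esnd (EVar 2)) (ELit 1)))))"

definition upd_body :: expr where
  "upd_body = ECase (efst (EVar 0)) ENil
     (EIf (EOp Less (efst (esnd (EVar 2))) (ELit 1))
       (ECons (esnd (esnd (EVar 2))) (EVar 1))
       (ECons (EVar 0) (ECall fUPD (ECons (EVar 1)
         (ECons (EOp Sub (efst (esnd (EVar 2))) (ELit 1)) (esnd (esnd (EVar 2))))))))"

definition add_all_body :: expr where
  "add_all_body = ECase (efst (EVar 0)) (esnd (esnd (EVar 0)))
     (ECall fADDALL (ECons (EVar 1) (ECons (efst (esnd (EVar 2)))
       (ECall fUPD (ECons (esnd (esnd (EVar 2))) (ECons (efst (EVar 0))
         (EOp Add (ECall fNTH (ECons (esnd (esnd (EVar 2))) (efst (EVar 0))))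
           (efst (esnd (EVar 2)))))))))) "

text \<open>There is no equality test, so inequality is decided by two comparisons.\<close>

definition remove_body :: expr where
  "remove_body = ECase (efst (EVar 0)) ENil
     (ELet (ECall fREMOVE (ECons (EVar 1) (esnd (EVar 2))))
       (EIf (EOp Less (EVar 1) (esnd (EVar 3))) (ECons (EVar 1) (EVar 0))
         (EIf (EOp Less (esnd (EVar 3)) (EVar 1)) (ECons (EVar 1) (EVar 0)) (EVar 0))))"

definition slack_body :: expr where
  "slack_body =
     EOp Sub
       (EOp Sub
         (ECall fNTH (ECons (ECall fNTH (ECons (efst (esnd (esnd (EVar 0)))) (efst (EVar 0))))
           (efst (esnd (EVar 0)))))
         (ECall fNTH (ECons (efst (esnd (esnd (esnd (EVar 0))))) (efst (EVar 0)))))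
       (ECall fNTH (ECons (esnd (esnd (esnd (esnd (EVar 0))))) (efst (esnd (EVar 0)))))"

definition scan_cols_body :: expr where
  "scan_cols_body = ECase (efst (EVar 0)) (efst (esnd (EVar 0)))
     (ELet (ECall fSLACK (ECons (efst (efst (esnd (esnd (EVar 2)))))
         (ECons (EVar 0) (esnd (esnd (esnd (EVar 2)))))))
       (ECall fSCANC (ECons (EVar 2) (ECons
         (EIf (EOp Less (EVar 0) (efst (efst (esnd (EVar 3)))))
           (ECons (EVar 0) (ECons (EVar 1) (efst (esnd (esnd (EVar 3))))))
           (efst (esnd (EVar 3))))
         (esnd (esnd (EVar 3)))))))"

definition scan_rows_body :: expr where
  "scan_rows_body = ECase (efst (EVar 0)) (efst (esnd (EVar 0)))
     (ECall fSCANR (ECons (EVar 1) (ECons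
       (ECall fSCANC (ECons (efst (esnd (esnd (EVar 2))))
         (ECons (efst (esnd (EVar 2))) (ECons (EVar 0) (esnd (esnd (esnd (EVar 2))))))))
       (esnd (esnd (EVar 2))))))"

text \<open>Skips \<open>i\<close> components: \<open>efst (tup i e)\<close> is component
  \<open>i\<close>, counted from 0, and \<open>tup i e\<close> itself is the last component of a
  tuple of length \<open>i + 1\<close>.\<close>

definition tup :: "nat \<Rightarrow> expr \<Rightarrow> expr" where
  "tup i e = (esnd ^^ i) e"

lemma tup_simps:
  "tup 1 e = esnd e"
  "tup 2 e = esnd (esnd e)"
  "tup 3 e = esnd (esnd (esnd e))"
  "tup 4 e = esnd (esnd (esnd (esnd e)))"
  "tup 5 e = esnd (esnd (esnd (esnd (esnd e))))"
  "tup 6 e = esnd (esnd (esnd (esnd (esnd (esnd e)))))"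
  by (simp_all add: tup_def numeral_eq_Suc)

text \<open>One tree step on the argument \<open>(C, u, v, m, R, Z, ts)\<close>. After all bindings
  the indices 0 to 6 hold \<open>m ! t\<close>, the new matching, the new \<open>v\<close>, the new
  \<open>u\<close>, the scan result, the triple \<open>(C, u, v)\<close> and the argument. The scan
  starts from the first tree entry and the first unreached position, so its initial value is a
  genuine candidate. Negation is written as subtraction from 0, hence the form
  \<open>0 - \<delta>\<close> in the lemmas.\<close>

definition grow_body :: expr where
  "grow_body =
     ELet (ECons (efst (EVar 0)) (ECons (efst (esnd (EVar 0))) (efst (esnd (esnd (EVar 0))))))
     (ELet (ECall fSCANR (ECons (efst (tup 4 (EVar 1)))
        (ECons (ECons (ECall fSLACK (ECons (efst (efst (efst (tup 4 (EVar 1)))))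
                          (ECons (efst (tup 6 (EVar 1))) (EVar 0))))
                  (ECons (efst (tup 6 (EVar 1))) (efst (efst (tup 4 (EVar 1))))))
          (ECons (tup 6 (EVar 1)) (EVar 0)))))
     (ELet (ECall fADDALL (ECons (efst (tup 4 (EVar 2)))
        (ECons (efst (EVar 0)) (efst (esnd (EVar 2))))))
     (ELet (ECall fADDALL (ECons (efst (tup 5 (EVar 3)))
        (ECons (EOp Sub (ELit 0) (efst (EVar 1))) (efst (tup 2 (EVar 3))))))
     (ELet (ECall fUPD (ECons (tup 3 (EVar 2))
        (ECons (efst (esnd (EVar 2))) (efst (tup 2 (EVar 2))))))
     (ELet (ECall fNTH (ECons (efst (tup 3 (EVar 5))) (efst (esnd (EVar 3)))))
     (EIf (EOp Less (EVar 0) (ELit 0))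
        (ECons (EVar 3) (ECons (EVar 2) (EVar 1)))
        (ECall fGROW (ECons (efst (EVar 6)) (ECons (EVar 3) (ECons (EVar 2)
          (ECons (efst (tup 3 (EVar 6)))
            (ECons (ECons (ECons (EVar 0) (EVar 1)) (efst (tup 4 (EVar 6))))
              (ECons (ECons (ECons (efst (esnd (EVar 4))) (EVar 1)) (efst (tup 5 (EVar 6))))
                (ECall fREMOVE (ECons (tup 6 (EVar 6)) (efst (esnd (EVar 4))))))))))))))))))"

text \<open>The argument is \<open>(jobs still to insert, C, all positions, u, v, m)\<close>. Each
  stage starts from the tree with the root alone and no reached position.\<close>

definition stages_body :: expr where
  "stages_body = ECase (efst (EVar 0)) (tup 5 (EVar 0))
     (ELet (ECall fGROW (ECons (efst (tup 1 (EVar 2))) (ECons (efst (tup 3 (EVar 2)))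
         (ECons (efst (tup 4 (EVar 2))) (ECons (tup 5 (EVar 2))
           (ECons (ECons (ECons (EVar 0) (tup 5 (EVar 2))) ENil)
             (ECons ENil (efst (tup 2 (EVar 2))))))))))
       (ECall fSTAGES (ECons (EVar 2) (ECons (efst (tup 1 (EVar 3)))
         (ECons (efst (tup 2 (EVar 3))) (EVar 0))))))"

definition dens_body :: expr where
  "dens_body = ECase (EVar 0) (ELit 1) (EOp Mul (esnd (EVar 0)) (ECall fDENS (EVar 1)))"

text \<open>
  A scenario \<open>(p, d)\<close> is encoded exactly like the list \<open>p # d\<close>, so that a whole instance is a list of
  lists of rationals.
\<close>

definition all_dens_body :: expr where
  "all_dens_body = ECase (EVar 0) (ELit 1) (EOp Mul (ECall fDENS (EVar 0)) (ECall fALLDENS (EVar 1)))"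

definition entry_body :: expr where
  "entry_body = ECase (efst (EVar 0)) (ELit 0)
     (EOp Add
       (EOp Mul
         (EOp Mul (efst (efst (EVar 0))) (EOp Div (tup 3 (EVar 2)) (esnd (efst (EVar 0)))))
         (ECall fPEN (ECons (ECall fNTH (ECons (esnd (EVar 0)) (efst (tup 1 (EVar 2)))))
           (tup 2 (EVar 2)))))
       (ECall fENTRY (ECons (EVar 1) (tup 1 (EVar 2)))))"

definition row_body :: expr where
  "row_body = ECase (efst (EVar 0)) ENil
     (ECons
       (EOp Mul (efst (tup 1 (EVar 2)))
         (ECall fENTRY (ECons (tup 4 (EVar 2)) (ECons (efst (tup 2 (EVar 2)))
           (ECons (EVar 0) (efst (tup 3 (EVar 2))))))))
       (ECall fROW (ECons (EVar 1) (tup 1 (EVar 2)))))"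

definition mat_body :: expr where
  "mat_body = ECase (efst (EVar 0)) ENil
     (ECons
       (ECall fROW (ECons (efst (tup 2 (EVar 2)))
         (ECons (EOp Mul (efst (EVar 0)) (EOp Div (efst (tup 3 (EVar 2))) (esnd (EVar 0))))
           (ECons (efst (tup 1 (EVar 2))) (tup 3 (EVar 2))))))
       (ECall fMAT (ECons (EVar 1)
         (ECons (EOp Add (efst (tup 1 (EVar 2))) (ELit 1)) (tup 2 (EVar 2))))))"

definition upto_body :: expr where
  "upto_body = ECase (efst (EVar 0)) ENil
     (ECons (esnd (EVar 2)) (ECall fUPTO (ECons (EVar 1) (EOp Add (esnd (EVar 2)) (ELit 1)))))"

definition const_body :: expr where
  "const_body = ECase (efst (EVar 0)) ENil
     (ECons (esnd (EVar 2)) (ECall fCONST (ECons (EVar 1) (esnd (EVar 2)))))"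

text \<open>The list of weights serves as a unary representation of \<open>n\<close>. The index list
  built from it is used for the columns of the matrix, for the stages and for the positions.\<close>

definition main_body :: expr where
  "main_body =
     ELet (ECall fUPTO (ECons (efst (EVar 0)) (ELit 0)))
     (ECall fSTAGES (ECons (EVar 0) (ECons
        (ECall fMAT (ECons (efst (EVar 1)) (ECons (ELit 0) (ECons (EVar 0)
          (ECons (ECall fALLDENS (EVar 1)) (esnd (EVar 1)))))))
        (ECons (EVar 0)
          (ECons (ECall fCONST (ECons (efst (EVar 1)) (ELit 0)))
            (ECons (ECall fCONST (ECons (efst (EVar 1)) (ELit 0)))
              (ECall fCONST (ECons (efst (EVar 1)) (ELit (- 1))))))))))"

text \<open>The last function computes the penalty of a job; it is the only one that depends on the cost.\<close>

definition prog :: "expr \<Rightarrow> program" where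
  "prog pe = [main_body, nth_body, upd_body, add_all_body, remove_body, slack_body,
     scan_cols_body, scan_rows_body, grow_body, stages_body, dens_body, all_dens_body, entry_body,
     row_body, mat_body, upto_body, const_body, pe]"

lemma length_distinct_fst:
  assumes "distinct (map fst R)" "\<forall>e\<in>set R. fst e < (n :: nat)"
  shows "length R \<le> n"
proof -
  have "length R = card (set (map fst R))" using distinct_card[OF assms(1)] by simp
  also have "\<dots> \<le> card {..<n}" by (rule card_mono) (use assms in auto)
  finally show ?thesis by simp
qed

text \<open>\<open>X\<close> bounds all integers that are operands of a run, \<open>L\<close> their bit lengths, and \<open>N\<close> the lengths of all lists.\<close>

locale machine =
  fixes pe :: expr and X :: int and L N :: nat
  assumes small: "\<bar>x\<bar> \<le> X \<Longrightarrow> int_size x \<le> L"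
    and N_le_X: "int N + 1 \<le> X"
begin

abbreviation ev where "ev \<equiv> evaluates_within (prog pe)"

definition runs :: "nat \<Rightarrow> val \<Rightarrow> val \<Rightarrow> nat \<Rightarrow> bool" where
  "runs f x v t \<longleftrightarrow> f < length (prog pe) \<and> ev [x] (prog pe ! f) v t"

lemma ev_call: "ev \<Gamma> a u s \<Longrightarrow> runs f u v t \<Longrightarrow> ev \<Gamma> (ECall f a) v (1 + s + t)"
  unfolding runs_def by (blast intro: within_call)

lemma runs_mono: "runs f x v s \<Longrightarrow> s \<le> t \<Longrightarrow> runs f x v t"
  unfolding runs_def using within_mono by blast

lemma ev_op:
  assumes "ev \<Gamma> a (VInt x) s" "ev \<Gamma> b (VInt y) t" "\<bar>x\<bar> \<le> X" "\<bar>y\<bar> \<le> X"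
  shows "ev \<Gamma> (EOp f a b) (VInt (arith f x y)) (1 + s + t + 2 * L)"
proof -
  obtain s' t' where "evaluates (prog pe) \<Gamma> a (VInt x) s'" "s' \<le> s"
    "evaluates (prog pe) \<Gamma> b (VInt y) t'" "t' \<le> t"
    using assms unfolding evaluates_within_def by blast
  then have "evaluates (prog pe) \<Gamma> (EOp f a b) (VInt (arith f x y))
      (1 + s' + t' + int_size x + int_size y)"
    "1 + s' + t' + int_size x + int_size y \<le> 1 + s + t + 2 * L"
    using evaluates.Op small[OF assms(3)] small[OF assms(4)] by (blast, simp)
  then show ?thesis unfolding evaluates_within_def by blast
qed

lemmas ev_ops = ev_op[where f = Add, unfolded arith.simps] ev_op[where f = Sub, unfolded arith.simps]
  ev_op[where f = Mul, unfolded arith.simps] ev_op[where f = Div, unfolded arith.simps]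
  ev_op[where f = Less, unfolded arith.simps]

lemma ev_if_true:
  assumes "ev \<Gamma> a (VInt x) s" "ev \<Gamma> b (VInt y) t" "\<bar>x\<bar> \<le> X" "\<bar>y\<bar> \<le> X" "x < y" "ev \<Gamma> c v t1"
  shows "ev \<Gamma> (EIf (EOp Less a b) c d) v (2 + s + t + 2 * L + t1)"
proof -
  obtain r where r: "evaluates (prog pe) \<Gamma> (EOp Less a b) (VInt 1) r" "r \<le> 1 + s + t + 2 * L"
    using ev_op[OF assms(1-4), of Less] assms(5) unfolding evaluates_within_def by auto
  obtain q where q: "evaluates (prog pe) \<Gamma> c v q" "q \<le> t1"
    using assms(6) unfolding evaluates_within_def by auto
  have "evaluates (prog pe) \<Gamma> (EIf (EOp Less a b) c d) v (1 + r + q)"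
    by (rule evaluates.If_True[OF r(1) _ q(1)]) simp
  moreover have "1 + r + q \<le> 2 + s + t + 2 * L + t1" using r q by simp
  ultimately show ?thesis unfolding evaluates_within_def by blast
qed

lemma ev_if_false:
  assumes "ev \<Gamma> a (VInt x) s" "ev \<Gamma> b (VInt y) t" "\<bar>x\<bar> \<le> X" "\<bar>y\<bar> \<le> X" "\<not> x < y" "ev \<Gamma> d v t1"
  shows "ev \<Gamma> (EIf (EOp Less a b) c d) v (2 + s + t + 2 * L + t1)"
proof -
  obtain r where r: "evaluates (prog pe) \<Gamma> (EOp Less a b) (VInt 0) r" "r \<le> 1 + s + t + 2 * L"
    using ev_op[OF assms(1-4), of Less] assms(5) unfolding evaluates_within_def by auto
  obtain q where q: "evaluates (prog pe) \<Gamma> d v q" "q \<le> t1"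
    using assms(6) unfolding evaluates_within_def by auto
  have "evaluates (prog pe) \<Gamma> (EIf (EOp Less a b) c d) v (1 + r + q)"
    by (rule evaluates.If_False[OF r(1) q(1)])
  moreover have "1 + r + q \<le> 2 + s + t + 2 * L + t1" using r q by simp
  ultimately show ?thesis unfolding evaluates_within_def by blast
qed

text \<open>The bounds of both branches are added, so the rule applies without knowing the outcome,
  and each branch is run under its own condition only.\<close>

lemma ev_if_less:
  assumes "ev \<Gamma> a (VInt x) s" "ev \<Gamma> b (VInt y) t" "\<bar>x\<bar> \<le> X" "\<bar>y\<bar> \<le> X"
    and "x < y \<Longrightarrow> ev \<Gamma> c v t1" "\<not> x < y \<Longrightarrow> ev \<Gamma> d w t2"
  shows "ev \<Gamma> (EIf (EOp Less a b) c d) (if x < y then v else w) (2 + s + t + 2 * L + (t1 + t2))"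
proof (cases "x < y")
  case True
  show ?thesis using within_mono[OF ev_if_true[OF assms(1-4) True assms(5)[OF True]]] True by simp
next
  case False
  show ?thesis using within_mono[OF ev_if_false[OF assms(1-4) False assms(6)[OF False]]] False by simp
qed

lemmas ev_core = within_var within_lit within_nil within_cons within_let ev_call ev_ops
lemmas ev_rules = ev_core within_fst within_snd ev_if_less

lemma runsI:
  "ev [x] nth_body v t \<Longrightarrow> runs fNTH x v t"
  "ev [x] upd_body v t \<Longrightarrow> runs fUPD x v t"
  "ev [x] add_all_body v t \<Longrightarrow> runs fADDALL x v t"
  "ev [x] remove_body v t \<Longrightarrow> runs fREMOVE x v t"
  "ev [x] slack_body v t \<Longrightarrow> runs fSLACK x v t"
  "ev [x] scan_cols_body v t \<Longrightarrow> runs fSCANC x v t"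
  "ev [x] scan_rows_body v t \<Longrightarrow> runs fSCANR x v t"
  "ev [x] grow_body v t \<Longrightarrow> runs fGROW x v t"
  "ev [x] stages_body v t \<Longrightarrow> runs fSTAGES x v t"
  "ev [x] dens_body v t \<Longrightarrow> runs fDENS x v t"
  "ev [x] all_dens_body v t \<Longrightarrow> runs fALLDENS x v t"
  "ev [x] entry_body v t \<Longrightarrow> runs fENTRY x v t"
  "ev [x] row_body v t \<Longrightarrow> runs fROW x v t"
  "ev [x] mat_body v t \<Longrightarrow> runs fMAT x v t"
  "ev [x] upto_body v t \<Longrightarrow> runs fUPTO x v t"
  "ev [x] const_body v t \<Longrightarrow> runs fCONST x v t"
  "ev [x] pe v t \<Longrightarrow> runs fPEN x v t"
  "ev [x] main_body v t \<Longrightarrow> runs fMAIN x v t"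
  unfolding runs_def prog_def by simp_all

text \<open>A generous bound on the constant work of a body: 100 steps and ten arithmetic operations
  with two operands of \<open>L\<close> bits each. Larger bodies are charged a multiple of
  it.\<close>

definition unit_time :: nat where "unit_time = 100 + 20 * L"

text \<open>The time depends on the actual length, as the induction requires; callers use the
  uniform version with \<open>N\<close>. Other list functions are treated in the same two
  steps.\<close>

lemma runs_nth_aux:
  assumes "i < length xs" "length xs \<le> N"
  shows "runs fNTH (VCons (encl f xs) (VInt (int i))) (f (xs ! i)) (length xs * unit_time)"
  using assms
proof (induction xs arbitrary: i)
  case (Cons x xs)
  have X: "\<bar>int i\<bar> \<le> X" "\<bar>1\<bar> \<le> X" using Cons.prems N_le_X by auto
  \<comment> \<open>The recursive call receives the integer \<open>int i - 1\<close>, which encodes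
    an index only in the branch where it is made.\<close>
  have IH: "runs fNTH (VCons (encl f xs) (VInt (int i - 1))) (f (xs ! (i - 1))) (length xs * unit_time)"
    if "\<not> int i < 1"
  proof -
    have "int i - 1 = int (i - 1)" using that by auto
    then show ?thesis using Cons.IH[of "i - 1"] Cons.prems that by auto
  qed
  show ?case
    apply (rule runsI, unfold nth_body_def list.map enc_list.simps)
    apply (rule within_conv)
      apply (rule within_case_cons)
       apply (rule ev_rules X | erule IH)+
     apply (use Cons.prems in \<open>auto simp: nth_Cons'\<close>)[1]
    apply (simp add: unit_time_def)
    done
qed simp


definition t_nth where "t_nth = N * unit_time"

lemma runs_nth:
  assumes "i < length xs" "length xs \<le> N"
  shows "runs fNTH (VCons (encl f xs) (vnat i)) (f (xs ! i)) t_nth"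
  using runs_nth_aux[OF assms] assms(2) unfolding t_nth_def by (blast intro: runs_mono mult_le_mono1)

lemma runs_upd_aux:
  assumes "length xs \<le> N" "i \<le> N"
  shows "runs fUPD (VCons (encl f xs) (VCons (vnat i) (f y))) (encl f (xs[i := y]))
    (length xs * unit_time + unit_time)"
  using assms
proof (induction xs arbitrary: i)
  case Nil
  show ?case
    apply (rule runsI, unfold upd_body_def list.map enc_list.simps)
    apply (rule within_conv)
      apply (rule within_case_nil)
       apply (rule ev_rules)+
     apply (auto simp: unit_time_def)
    done
next
  case (Cons x xs)
  have X: "\<bar>int i\<bar> \<le> X" "\<bar>1\<bar> \<le> X" using Cons.prems N_le_X by auto
  have IH: "runs fUPD (VCons (encl f xs) (VCons (VInt (int i - 1)) (f y))) (encl f (xs[i - 1 := y]))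
      (length xs * unit_time + unit_time)"
    if "\<not> int i < 1"
  proof -
    have "int i - 1 = int (i - 1)" using that by auto
    then show ?thesis using Cons.IH[of "i - 1"] Cons.prems that by auto
  qed
  show ?case
    apply (rule runsI, unfold upd_body_def list.map enc_list.simps)
    apply (rule within_conv)
      apply (rule within_case_cons)
       apply (rule ev_rules X | erule IH)+
     apply (cases i; simp)
    apply (simp add: unit_time_def)
    done
qed

definition t_upd where "t_upd = N * unit_time + unit_time"

lemma runs_upd:
  assumes "length xs \<le> N" "i \<le> N"
  shows "runs fUPD (VCons (encl f xs) (VCons (vnat i) (f y))) (encl f (xs[i := y])) t_upd"
proof (rule runs_mono[OF runs_upd_aux[OF assms]])
  show "length xs * unit_time + unit_time \<le> t_upd" using assms(1) unfolding t_upd_def by simp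
qed

definition t_add where "t_add = N * (t_nth + t_upd + unit_time) + unit_time"

lemma runs_add_all_aux:
  assumes "distinct (map fst R)" "\<And>e. e \<in> set R \<Longrightarrow> fst e < length u \<and> \<bar>u ! fst e\<bar> \<le> X"
    "\<bar>\<delta>\<bar> \<le> X" "length u \<le> N"
  shows "runs fADDALL (VCons (encl vent R) (VCons (VInt \<delta>) (encl VInt u))) (encl VInt (add_all \<delta> R u))
    (length R * (t_nth + t_upd + unit_time) + unit_time)"
  using assms
proof (induction R arbitrary: u)
  case Nil
  show ?case
    apply (rule runsI, unfold add_all_body_def list.map enc_list.simps)
    apply (rule within_conv)
      apply (rule within_case_nil)
       apply (rule ev_rules)+
     apply (auto simp: unit_time_def)
    done
next
  case (Cons e R)
  have lt: "fst e < length u" and X: "\<bar>u ! fst e\<bar> \<le> X" "\<bar>\<delta>\<bar> \<le> X" using Cons.prems by auto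
  let ?u = "u[fst e := u ! fst e + \<delta>]"
  have IH: "runs fADDALL (VCons (encl vent R) (VCons (VInt \<delta>) (encl VInt ?u))) (encl VInt (add_all \<delta> R ?u))
    (length R * (t_nth + t_upd + unit_time) + unit_time)"
  proof (rule Cons.IH)
    show "fst f < length ?u \<and> \<bar>?u ! fst f\<bar> \<le> X" if "f \<in> set R" for f
    proof -
      \<comment> \<open>Entries still to be changed have their original values, so bounds on the
        original entries cover all operands.\<close>
      have "fst e \<notin> fst ` set R" using Cons.prems(1) by simp
      then have "fst f \<noteq> fst e" using that by (metis imageI)
      then show ?thesis using that Cons.prems(2)[of f] by simp
    qed
  qed (use Cons.prems in auto)
  have nth: "runs fNTH (VCons (encl VInt u) (vnat (fst e))) (VInt (u ! fst e)) t_nth"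
    by (rule runs_nth[OF lt Cons.prems(4)])
  have upd: "runs fUPD (VCons (encl VInt u) (VCons (vnat (fst e)) (VInt (u ! fst e + \<delta>)))) (encl VInt ?u) t_upd"
    by (rule runs_upd) (use lt Cons.prems(4) in linarith)+
  show ?case
    apply (rule runsI, unfold add_all_body_def list.map(2) enc_list.simps(2))
    apply (rule within_conv)
      apply (rule within_case_cons)
       apply (rule ev_rules X nth upd IH)+
     apply simp
    apply (simp add: unit_time_def)
    done
qed

lemma runs_add_all:
  assumes "distinct (map fst R)" "\<And>e. e \<in> set R \<Longrightarrow> fst e < length u \<and> \<bar>u ! fst e\<bar> \<le> X"
    "\<bar>\<delta>\<bar> \<le> X" "length u \<le> N" "length R \<le> N"
  shows "runs fADDALL (VCons (encl vent R) (VCons (VInt \<delta>) (encl VInt u))) (encl VInt (add_all \<delta> R u)) t_add"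
  by (rule runs_mono[OF runs_add_all_aux[OF assms(1-4)]])
    (auto simp: t_add_def intro!: mult_le_mono1 assms)

definition t_rem where "t_rem = N * unit_time + unit_time"

lemma runs_remove_aux:
  assumes "\<forall>a\<in>set ts. a \<le> N" "t \<le> N"
  shows "runs fREMOVE (VCons (encl vnat ts) (vnat t)) (encl vnat (filter (\<lambda>a. a \<noteq> t) ts))
    (length ts * unit_time + unit_time)"
  using assms
proof (induction ts)
  case Nil
  show ?case
    apply (rule runsI, unfold remove_body_def list.map enc_list.simps)
    apply (rule within_conv)
      apply (rule within_case_nil)
       apply (rule ev_rules)+
     apply (auto simp: unit_time_def)
    done
next
  case (Cons a ts)
  have X: "\<bar>int a\<bar> \<le> X" "\<bar>int t\<bar> \<le> X" using Cons.prems N_le_X by auto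
  have IH: "runs fREMOVE (VCons (encl vnat ts) (vnat t)) (encl vnat (filter (\<lambda>a. a \<noteq> t) ts))
    (length ts * unit_time + unit_time)"
    using Cons by simp
  show ?case
    apply (rule runsI, unfold remove_body_def list.map(2) enc_list.simps(2))
    apply (rule within_conv)
      apply (rule within_case_cons)
       apply (rule ev_rules X IH)+
     apply simp
    apply (simp add: unit_time_def)
    done
qed

lemma runs_remove:
  assumes "\<forall>a\<in>set ts. a \<le> N" "t \<le> N" "length ts \<le> N"
  shows "runs fREMOVE (VCons (encl vnat ts) (vnat t)) (encl vnat (filter (\<lambda>a. a \<noteq> t) ts)) t_rem"
  by (rule runs_mono[OF runs_remove_aux[OF assms(1,2)]])
    (auto simp: t_rem_def intro!: mult_le_mono1 assms)

section \<open>Runs of the Hungarian method with bounded dual variables\<close>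

definition sized :: "nat \<Rightarrow> int \<Rightarrow> int list list \<Rightarrow> int list \<Rightarrow> int list \<Rightarrow> bool" where
  "sized n M C u v \<longleftrightarrow> n \<le> N \<and> length C = n \<and> length u = n \<and> length v = n \<and>
     (\<forall>j<n. length (C ! j) = n) \<and> (\<forall>j<n. \<forall>t<n. \<bar>C ! j ! t\<bar> \<le> M) \<and>
     (\<forall>j<n. \<bar>u ! j\<bar> \<le> M) \<and> (\<forall>t<n. \<bar>v ! t\<bar> \<le> M)"

definition t_slack where "t_slack = 4 * t_nth + unit_time"

text \<open>The factor in \<open>4 * M \<le> X\<close> also covers the intermediate difference
  \<open>C ! j ! t - u ! j\<close>, which is an operand of the second subtraction.\<close>

lemma runs_slack:
  assumes "sized n M C u v" "4 * M \<le> X" "j < n" "t < n"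
  shows "runs fSLACK (VCons (vnat j) (VCons (vnat t) (vduals C u v))) (VInt (slack C u v j t)) t_slack"
proof -
  have M: "\<bar>C ! j ! t\<bar> \<le> M" "\<bar>u ! j\<bar> \<le> M" "\<bar>v ! t\<bar> \<le> M"
    and len: "length C = n" "length u = n" "length v = n" "length (C ! j) = n" "n \<le> N"
    using assms unfolding sized_def by auto
  have X: "\<bar>C ! j ! t\<bar> \<le> X" "\<bar>u ! j\<bar> \<le> X" "\<bar>v ! t\<bar> \<le> X" "\<bar>C ! j ! t - u ! j\<bar> \<le> X"
    using M assms(2) by linarith+
  have n1: "runs fNTH (VCons (encl (encl VInt) C) (vnat j)) (encl VInt (C ! j)) t_nth"
    by (rule runs_nth) (use len assms in auto)
  have n2: "runs fNTH (VCons (encl VInt (C ! j)) (vnat t)) (VInt (C ! j ! t)) t_nth"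
    by (rule runs_nth) (use len assms in auto)
  have n3: "runs fNTH (VCons (encl VInt u) (vnat j)) (VInt (u ! j)) t_nth"
    by (rule runs_nth) (use len assms in auto)
  have n4: "runs fNTH (VCons (encl VInt v) (vnat t)) (VInt (v ! t)) t_nth"
    by (rule runs_nth) (use len assms in auto)
  show ?thesis
    apply (rule runsI, unfold slack_body_def)
    apply (rule within_conv)
      apply (rule ev_rules X n1 n2 n3 n4)+
     apply (simp add: slack_def)
    apply (simp add: unit_time_def t_slack_def)
    done
qed

lemma slack_bound:
  assumes "sized n M C u v" "j < n" "t < n"
  shows "\<bar>slack C u v j t\<bar> \<le> 3 * M"
proof -
  have "\<bar>C ! j ! t\<bar> \<le> M" "\<bar>u ! j\<bar> \<le> M" "\<bar>v ! t\<bar> \<le> M" using assms unfolding sized_def by auto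
  then show ?thesis unfolding slack_def by linarith
qed

definition t_scanc where "t_scanc = N * (t_slack + unit_time) + unit_time"

lemma runs_scan_cols_aux:
  assumes "sized n M C u v" "4 * M \<le> X" "fst e < n" "set ts \<subseteq> {..<n}" "\<bar>fst b\<bar> \<le> 3 * M" "0 \<le> M"
  shows "runs fSCANC (VCons (encl vnat ts) (VCons (vbest b) (VCons (vent e) (vduals C u v))))
    (vbest (scan_cols (slack C u v) e ts b)) (length ts * (t_slack + unit_time) + unit_time)"
  using assms
proof (induction ts arbitrary: b)
  case Nil
  show ?case
    apply (rule runsI, unfold scan_cols_body_def list.map(1) enc_list.simps(1))
    apply (rule within_conv)
      apply (rule within_case_nil)
       apply (rule ev_rules)+
     apply (auto simp: unit_time_def)
    done
next
  case (Cons t ts)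
  let ?s = "slack C u v (fst e) t"
  have s: "\<bar>?s\<bar> \<le> 3 * M" by (rule slack_bound) (use Cons.prems in auto)
  have X: "\<bar>?s\<bar> \<le> X" "\<bar>fst b\<bar> \<le> X" using s Cons.prems by linarith+
  have sl: "runs fSLACK (VCons (vnat (fst e)) (VCons (vnat t) (vduals C u v))) (VInt ?s) t_slack"
    by (rule runs_slack) (use Cons.prems in auto)
  let ?b = "if ?s < fst b then (?s, t, e) else b"
  have "runs fSCANC (VCons (encl vnat ts) (VCons (vbest ?b) (VCons (vent e) (vduals C u v))))
    (vbest (scan_cols (slack C u v) e ts ?b)) (length ts * (t_slack + unit_time) + unit_time)"
    by (rule Cons.IH) (use Cons.prems s in auto)
  \<comment> \<open>\<open>ev_if_less\<close> yields a conditional between two encoded values; the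
    encoding has to be pulled out of it.\<close>
  moreover have "(if ?s < fst b then VCons (VInt ?s) (VCons (vnat t) (vent e)) else vbest b) = vbest ?b"
    by simp
  ultimately have IH: "runs fSCANC (VCons (encl vnat ts)
     (VCons (if ?s < fst b then VCons (VInt ?s) (VCons (vnat t) (vent e)) else vbest b) (VCons (vent e) (vduals C u v))))
    (vbest (scan_cols (slack C u v) e ts ?b)) (length ts * (t_slack + unit_time) + unit_time)"
    by (simp only:)
  show ?case
    apply (rule runsI, unfold scan_cols_body_def list.map(2) enc_list.simps(2))
    apply (rule within_conv)
      apply (rule within_case_cons)
       apply (rule ev_rules X sl IH)+
     apply simp
    apply (simp add: unit_time_def)
    done
qed

lemma runs_scan_cols:
  assumes "sized n M C u v" "4 * M \<le> X" "fst e < n" "set ts \<subseteq> {..<n}" "\<bar>fst b\<bar> \<le> 3 * M" "0 \<le> M"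
    "length ts \<le> N"
  shows "runs fSCANC (VCons (encl vnat ts) (VCons (vbest b) (VCons (vent e) (vduals C u v))))
    (vbest (scan_cols (slack C u v) e ts b)) t_scanc"
  by (rule runs_mono[OF runs_scan_cols_aux[OF assms(1-6)]])
    (auto simp: t_scanc_def intro!: mult_le_mono1 assms)

definition t_scanr where "t_scanr = N * (t_scanc + unit_time) + unit_time"

lemma runs_scan_rows_aux:
  assumes "sized n M C u v" "4 * M \<le> X" "\<forall>e\<in>set R. fst e < n" "set ts \<subseteq> {..<n}"
    "\<bar>fst b\<bar> \<le> 3 * M" "0 \<le> M" "length ts \<le> N"
  shows "runs fSCANR (VCons (encl vent R) (VCons (vbest b) (VCons (encl vnat ts) (vduals C u v))))
    (vbest (scan_rows (slack C u v) R ts b)) (length R * (t_scanc + unit_time) + unit_time)"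
  using assms
proof (induction R arbitrary: b)
  case Nil
  show ?case
    apply (rule runsI, unfold scan_rows_body_def list.map(1) enc_list.simps(1))
    apply (rule within_conv)
      apply (rule within_case_nil)
       apply (rule ev_rules)+
     apply (auto simp: unit_time_def)
    done
next
  case (Cons e R)
  let ?b = "scan_cols (slack C u v) e ts b"
  have sl: "runs fSCANC (VCons (encl vnat ts) (VCons (vbest b) (VCons (vent e) (vduals C u v))))
      (vbest ?b) t_scanc"
    by (rule runs_scan_cols) (use Cons.prems in auto)
  have "\<bar>fst ?b\<bar> \<le> 3 * M"
    using scan_cols_in[of "slack C u v" e ts b] slack_bound[OF assms(1), of "fst e"] Cons.prems
    unfolding candidates_def by auto
  then have IH: "runs fSCANR (VCons (encl vent R) (VCons (vbest ?b) (VCons (encl vnat ts) (vduals C u v))))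
    (vbest (scan_rows (slack C u v) R ts ?b)) (length R * (t_scanc + unit_time) + unit_time)"
    by (intro Cons.IH) (use Cons.prems in auto)
  show ?case
    apply (rule runsI, unfold scan_rows_body_def list.map(2) enc_list.simps(2))
    apply (rule within_conv)
      apply (rule within_case_cons)
       apply (rule ev_rules sl IH)+
     apply simp
    apply (simp add: unit_time_def)
    done
qed

lemma runs_scan_rows:
  assumes "sized n M C u v" "4 * M \<le> X" "\<forall>e\<in>set R. fst e < n" "set ts \<subseteq> {..<n}"
    "\<bar>fst b\<bar> \<le> 3 * M" "0 \<le> M" "length ts \<le> N" "length R \<le> N"
  shows "runs fSCANR (VCons (encl vent R) (VCons (vbest b) (VCons (encl vnat ts) (vduals C u v))))
    (vbest (scan_rows (slack C u v) R ts b)) t_scanr"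
  by (rule runs_mono[OF runs_scan_rows_aux[OF assms(1-7)]])
    (auto simp: t_scanr_def intro!: mult_le_mono1 assms)

text \<open>Origin of the growth factor 4: a slack has three terms of size at most \<open>M\<close>,
  and it is added to or subtracted from a dual variable of size at most \<open>M\<close>.\<close>

lemma sized_add_all:
  assumes "sized n M C u v" "distinct (map fst R)" "distinct (map fst Z)" "j < n" "t < n"
  shows "sized n (4 * M) C (add_all (slack C u v j t) R u) (add_all (0 - slack C u v j t) Z v)"
proof -
  let ?d = "slack C u v j t"
  have d: "\<bar>?d\<bar> \<le> 3 * M" by (rule slack_bound[OF assms(1,4,5)])
  have "\<bar>add_all ?d R u ! i\<bar> \<le> 4 * M \<and> \<bar>add_all (0 - ?d) Z v ! i\<bar> \<le> 4 * M" if "i < n" for i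
  proof -
    have "\<bar>u ! i\<bar> \<le> M" "\<bar>v ! i\<bar> \<le> M" "i < length u" "i < length v"
      using assms(1) that unfolding sized_def by auto
    then show ?thesis using add_all_nth[OF assms(2), of i u ?d] add_all_nth[OF assms(3), of i v "0 - ?d"] d
      by auto
  qed
  moreover have "0 \<le> M" using d by linarith
  then have "\<bar>C ! i ! s\<bar> \<le> 4 * M" if "i < n" "s < n" for i s
    using assms(1) that unfolding sized_def by fastforce
  ultimately show ?thesis using assms(1) unfolding sized_def by auto
qed

lemma sized_mono: "sized n M C u v \<Longrightarrow> M \<le> M' \<Longrightarrow> sized n M' C u v"
  unfolding sized_def by (meson order_trans)

definition t_step where
  "t_step = t_slack + t_scanr + 2 * t_add + t_upd + t_nth + t_rem + 5 * unit_time"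

abbreviation vtree where
  "vtree C u v m R Z ts \<equiv> VCons (encl (encl VInt) C) (VCons (encl VInt u) (VCons (encl VInt v)
     (VCons (encl VInt m) (VCons (encl vent R) (VCons (encl vent Z) (encl vnat ts))))))"

abbreviation vstate where
  "vstate u v m \<equiv> VCons (encl VInt u) (VCons (encl VInt v) (encl VInt m))"

text \<open>Each step ends the stage or removes a position from \<open>ts\<close>, so there are at
  most \<open>length ts\<close> steps. The power of 4 has one factor per remaining position plus
  one, so passing from \<open>M\<close> to \<open>4 * M\<close> is paid for by the shorter
  list.\<close>

lemma runs_grow:
  assumes "tree_inv n C k m u v R Z ts" "sized n M C u v" "0 \<le> M" "4 ^ Suc (length ts) * M \<le> X"
    "length ts \<le> N" "\<forall>x\<in>set m. - 1 \<le> x" "\<forall>e\<in>set R. \<forall>x\<in>set (snd e). - 1 \<le> x"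
  shows "\<exists>u' v' m'. runs fGROW (vtree C u v m R Z ts) (vstate u' v' m') (length ts * t_step) \<and>
    stage_inv n C (Suc k) u' v' m' \<and> sized n (4 ^ length ts * M) C u' v' \<and> (\<forall>x\<in>set m'. - 1 \<le> x)"
  using assms
proof (induction "length ts" arbitrary: u v R Z ts M rule: less_induct)
  case less
  note inv = less.prems(1) and sz = less.prems(2)
  have len: "length u = n" "length v = n" "length m = n" "k < n"
    and dR: "distinct (map fst R)" and dZ: "distinct (map fst Z)"
    and Z: "fst ` set Z = {..<n} - set ts" and tsn: "set ts \<subseteq> {..<n}"
    and ts_ne: "\<exists>t\<in>set ts. m ! t < 0" and R_ne: "R \<noteq> []"
    and jm: "jobs m = image_mset int (mset_set {..<k})"
    and RD0: "\<forall>(j, mj)\<in>set R. j < n \<and> length mj = n \<and> jobs mj + {#int j#} = jobs m + {#int k#} \<and>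
        tight_duals n C u v mj \<and> (\<forall>t\<in>set ts. mj ! t = m ! t) \<and>
        (\<forall>t<n. t \<notin> set ts \<longrightarrow> 0 \<le> mj ! t \<longrightarrow> nat (mj ! t) \<in> fst ` set R)"
    using inv unfolding tree_inv_def by - (elim conjE, assumption)+
  have nN: "n \<le> N" using sz unfolding sized_def by blast
  have Rn: "\<forall>e\<in>set R. fst e < n" using RD0 by auto
  have Zn: "\<forall>e\<in>set Z. fst e < n" using Z by auto
  have lR: "length R \<le> N" using length_distinct_fst[OF dR Rn] nN by simp
  have lZ: "length Z \<le> N" using length_distinct_fst[OF dZ Zn] nN by simp
  obtain e0 R0 where R: "R = e0 # R0" using R_ne by (cases R) auto
  obtain t0 ts0 where ts: "ts = t0 # ts0" using ts_ne by (cases ts) auto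
  have encR: "encl vent R = VCons (vent e0) (encl vent R0)"
    and encts: "encl vnat ts = VCons (vnat t0) (encl vnat ts0)" using R ts by auto
  have "(4::int) \<le> 4 ^ Suc (length ts)" by simp
  then have "4 * M \<le> 4 ^ Suc (length ts) * M" using less.prems(3) by (rule mult_right_mono)
  then have M4: "4 * M \<le> X" using less.prems(4) by linarith
  have e0: "fst e0 < n" "t0 < n" using Rn tsn R ts by auto
  define s where "s = slack C u v"
  define b0 where "b0 = (s (fst e0) t0, t0, e0)"
  obtain \<delta> t j mj where b: "scan_rows s R ts b0 = (\<delta>, t, j, mj)"
    by (cases "scan_rows s R ts b0") auto
  have "b0 \<in> candidates s (set R) (set ts)" unfolding b0_def candidates_def using R ts by auto
  then have "(\<delta>, t, j, mj) \<in> candidates s (set R) (set ts)"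
    using scan_rows_in[of s R ts b0] b by auto
  then have \<delta>: "\<delta> = slack C u v j t" and t: "t \<in> set ts" and jR: "(j, mj) \<in> set R"
    unfolding candidates_def s_def by auto
  have min: "\<forall>e\<in>set R. \<forall>t'\<in>set ts. slack C u v j t \<le> slack C u v (fst e) t'"
    using scan_rows_le[of s R ts b0] b \<delta> by (auto simp: s_def)
  have tn: "t < n" and jn: "j < n" using t tsn jR Rn by auto
  have mjn: "length mj = n" using bspec[OF RD0 jR] by simp
  define u' where "u' = add_all \<delta> R u"
  define v' where "v' = add_all (0 - \<delta>) Z v"
  define m' where "m' = mj[t := int j]"
  note step = tree_step[OF inv jR t min, folded \<delta>, folded u'_def v'_def m'_def]
  have sz': "sized n (4 * M) C u' v'"
    unfolding u'_def v'_def \<delta> by (rule sized_add_all[OF sz dR dZ jn tn])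
  have m'_ge: "\<forall>x\<in>set m'. - 1 \<le> x"
  proof
    fix x assume "x \<in> set m'"
    then have "x = int j \<or> x \<in> set mj" using set_update_subset_insert unfolding m'_def by fast
    then show "- 1 \<le> x" using less.prems(7) jR by auto
  qed
  have \<delta>3: "\<bar>\<delta>\<bar> \<le> 3 * M" unfolding \<delta> by (rule slack_bound[OF sz jn tn])
  have bnd: "\<bar>\<delta>\<bar> \<le> X" "\<bar>0 - \<delta>\<bar> \<le> X" "\<bar>0::int\<bar> \<le> X" using \<delta>3 M4 less.prems(3) by linarith+
  \<comment> \<open>\<open>m ! t\<close> is an operand of the test for a free position. The
    invariant that all entries are at least -1 bounds the marker of free positions.\<close>
  have mt: "\<bar>m ! t\<bar> \<le> X"
  proof (cases "0 \<le> m ! t")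
    case True
    then have "m ! t \<in># jobs m" using len tn by (intro jobs_nth) simp_all
    then have "m ! t < int k" using jm by auto
    then show ?thesis using True len nN N_le_X by linarith
  next
    case False
    have "m ! t \<in> set m" using tn len by simp
    then show ?thesis using False less.prems(6) N_le_X by fastforce
  qed
  have c_slack: "runs fSLACK (VCons (vnat (fst e0)) (VCons (vnat t0) (vduals C u v)))
      (VInt (s (fst e0) t0)) t_slack"
    unfolding s_def by (rule runs_slack[OF sz M4 e0])
  have "\<bar>fst b0\<bar> \<le> 3 * M" unfolding b0_def s_def using slack_bound[OF sz e0] by simp
  then have "runs fSCANR (VCons (encl vent R) (VCons (vbest b0) (VCons (encl vnat ts) (vduals C u v))))
      (vbest (scan_rows s R ts b0)) t_scanr"
    unfolding s_def by (intro runs_scan_rows[OF sz M4 Rn tsn _ less.prems(3,5) lR])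
  then have c_scan: "runs fSCANR (VCons (encl vent R)
      (VCons (VCons (VInt (s (fst e0) t0)) (VCons (vnat t0) (vent e0))) (VCons (encl vnat ts) (vduals C u v))))
      (VCons (VInt \<delta>) (VCons (vnat t) (VCons (vnat j) (encl VInt mj)))) t_scanr"
    unfolding b unfolding b0_def fst_conv snd_conv .
  have c_u: "runs fADDALL (VCons (encl vent R) (VCons (VInt \<delta>) (encl VInt u))) (encl VInt u') t_add"
    unfolding u'_def
  proof (rule runs_add_all[OF dR _ bnd(1) _ lR])
    show "fst e < length u \<and> \<bar>u ! fst e\<bar> \<le> X" if "e \<in> set R" for e
    proof -
      have "\<bar>u ! fst e\<bar> \<le> M" using sz Rn that unfolding sized_def by auto
      then show ?thesis using Rn that len M4 less.prems(3) by fastforce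
    qed
  qed (use len nN in simp)
  have c_v: "runs fADDALL (VCons (encl vent Z) (VCons (VInt (0 - \<delta>)) (encl VInt v))) (encl VInt v') t_add"
    unfolding v'_def
  proof (rule runs_add_all[OF dZ _ bnd(2) _ lZ])
    show "fst e < length v \<and> \<bar>v ! fst e\<bar> \<le> X" if "e \<in> set Z" for e
    proof -
      have "\<bar>v ! fst e\<bar> \<le> M" using sz Zn that unfolding sized_def by auto
      then show ?thesis using Zn that len M4 less.prems(3) by fastforce
    qed
  qed (use len nN in simp)
  have c_upd: "runs fUPD (VCons (encl VInt mj) (VCons (vnat t) (vnat j))) (encl VInt m') t_upd"
    unfolding m'_def by (rule runs_upd) (use mjn tn nN in auto)
  have c_nth: "runs fNTH (VCons (encl VInt m) (vnat t)) (VInt (m ! t)) t_nth"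
    by (rule runs_nth) (use len tn nN in auto)
  have c_rem: "runs fREMOVE (VCons (encl vnat ts) (vnat t)) (encl vnat (filter (\<lambda>a. a \<noteq> t) ts)) t_rem"
    by (rule runs_remove) (use tsn tn nN less.prems(5) in auto)
  note calls = c_slack c_scan c_u c_v c_upd c_nth c_rem
  have len_pos: "t_step \<le> length ts * t_step" using ts by simp
  show ?case
  proof (cases "m ! t < 0")
    case True
    have "runs fGROW (vtree C u v m R Z ts) (vstate u' v' m') (length ts * t_step)"
      apply (rule runsI, unfold grow_body_def tup_simps)
      apply (rule within_mono)
       apply (rule ev_core within_fst_eq within_snd_eq refl encR encts bnd mt calls ev_if_true True)+
      apply (rule order_trans[OF _ len_pos])
      apply (simp add: t_step_def unit_time_def)
      done
    moreover have "sized n (4 ^ length ts * M) C u' v'"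
    proof (rule sized_mono[OF sz'])
      have "(4::int) \<le> 4 ^ length ts" using ts by simp
      then show "4 * M \<le> 4 ^ length ts * M" using less.prems(3) by (rule mult_right_mono)
    qed
    ultimately show ?thesis using step(1)[OF True] m'_ge by blast
  next
    case False
    define a where "a = nat (m ! t)"
    have a: "m ! t = int a" using False unfolding a_def by simp
    let ?ts = "filter (\<lambda>a. a \<noteq> t) ts" and ?R = "(a, m') # R" and ?Z = "(t, m') # Z"
    have lt: "length ?ts < length ts" using t by (intro length_filter_less) auto
    have pw: "(4::int) ^ length ?ts * (4 * M) \<le> 4 ^ length ts * M"
    proof -
      have "(4::int) ^ Suc (length ?ts) \<le> 4 ^ length ts" using lt by (intro power_increasing) auto
      then have "(4::int) ^ Suc (length ?ts) * M \<le> 4 ^ length ts * M"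
        using less.prems(3) by (rule mult_right_mono)
      then show ?thesis by (simp add: ac_simps)
    qed
    have "\<exists>u'' v'' m''. runs fGROW (vtree C u' v' m ?R ?Z ?ts) (vstate u'' v'' m'') (length ?ts * t_step) \<and>
      stage_inv n C (Suc k) u'' v'' m'' \<and> sized n (4 ^ length ?ts * (4 * M)) C u'' v'' \<and> (\<forall>x\<in>set m''. - 1 \<le> x)"
    proof (rule less.hyps[OF lt])
      show "tree_inv n C k m u' v' ?R ?Z ?ts" using step(2)[OF False] unfolding a_def .
      show "4 ^ Suc (length ?ts) * (4 * M) \<le> X" using pw less.prems(4) by simp
    qed (use sz' less.prems lt m'_ge in auto)
    then obtain u'' v'' m'' where
      rec: "runs fGROW (vtree C u' v' m ?R ?Z ?ts) (vstate u'' v'' m'') (length ?ts * t_step)"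
      and post: "stage_inv n C (Suc k) u'' v'' m''" "sized n (4 ^ length ?ts * (4 * M)) C u'' v''"
        "\<forall>x\<in>set m''. - 1 \<le> x" by blast
    \<comment> \<open>The program puts the integer \<open>m ! t\<close> into the new tree entry,
      while tree entries are encodings of natural numbers; \<open>a\<close> reconciles the
      two.\<close>
    have c_rec: "runs fGROW (VCons (encl (encl VInt) C) (VCons (encl VInt u') (VCons (encl VInt v')
       (VCons (encl VInt m) (VCons (VCons (VCons (VInt (m ! t)) (encl VInt m')) (encl vent R))
       (VCons (VCons (VCons (vnat t) (encl VInt m')) (encl vent Z)) (encl vnat ?ts)))))))
       (vstate u'' v'' m'') (length ?ts * t_step)"
      using rec unfolding list.map(2) enc_list.simps(2) fst_conv snd_conv a .
    have "length ?ts * t_step + t_step \<le> length ts * t_step"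
      using mult_le_mono1[of "Suc (length ?ts)" "length ts" t_step] lt by simp
    then have time: "x \<le> length ts * t_step" if "x \<le> length ?ts * t_step + t_step" for x
      using that by linarith
    have "runs fGROW (vtree C u v m R Z ts) (vstate u'' v'' m'') (length ts * t_step)"
      apply (rule runsI, unfold grow_body_def tup_simps)
      apply (rule within_mono)
       apply (rule ev_core within_fst_eq within_snd_eq refl encR encts bnd mt calls c_rec ev_if_false False)+
      apply (rule time)
      apply (simp add: t_step_def unit_time_def)
      done
    then show ?thesis using post sized_mono[OF post(2) pw] by blast
  qed
qed

definition t_stage where "t_stage = N * t_step + unit_time"

text \<open>A stage starts with all \<open>n\<close> positions unreached and so enlarges the bound
  by at most \<open>4 ^ n\<close>; the exponent \<open>n * (n - k)\<close> pays for the
  \<open>n - k\<close> stages still to come.\<close>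

lemma runs_stages:
  assumes "stage_inv n C k u v m" "sized n M C u v" "0 \<le> M" "4 ^ Suc (n * (n - k)) * M \<le> X"
    "\<forall>x\<in>set m. - 1 \<le> x" "k \<le> n"
  shows "\<exists>u' v' m'. runs fSTAGES (VCons (encl vnat [k..<n]) (VCons (encl (encl VInt) C)
      (VCons (encl vnat [0..<n]) (vstate u v m)))) (encl VInt m') ((n - k) * t_stage + unit_time) \<and>
    stage_inv n C n u' v' m'"
  using assms
proof (induction "n - k" arbitrary: k u v m M)
  case 0
  then have k: "k = n" by simp
  have nil: "encl vnat [n..<n] = VNil" by simp
  have "runs fSTAGES (VCons (encl vnat [n..<n]) (VCons (encl (encl VInt) C)
      (VCons (encl vnat [0..<n]) (vstate u v m)))) (encl VInt m) ((n - n) * t_stage + unit_time)"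
    apply (rule runsI, unfold stages_body_def nil tup_simps)
    apply (rule within_conv)
      apply (rule within_case_nil)
       apply (rule ev_rules)+
     apply (auto simp: unit_time_def)
    done
  then show ?case using 0 k by blast
next
  case (Suc d)
  then have kn: "k < n" by simp
  have n: "n = length [0..<n]" "n \<le> N" using Suc.prems(2) by (auto simp: sized_def)
  have pw: "4 ^ Suc n * M \<le> X" "4 ^ Suc (n * (n - Suc k)) * (4 ^ n * M) \<le> X"
  proof -
    have "n - k = Suc (n - Suc k)" using kn by simp
    then have *: "n * (n - k) = n + n * (n - Suc k)" by (metis mult_Suc_right)
    have "(4::int) ^ Suc n \<le> 4 ^ Suc (n * (n - k))" unfolding * by (intro power_increasing) auto
    then have "4 ^ Suc n * M \<le> 4 ^ Suc (n * (n - k)) * M" using Suc.prems(3) by (rule mult_right_mono)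
    then show "4 ^ Suc n * M \<le> X" using Suc.prems(4) by linarith
    show "4 ^ Suc (n * (n - Suc k)) * (4 ^ n * M) \<le> X"
      using Suc.prems(4) unfolding * by (simp add: power_add ac_simps)
  qed
  obtain u1 v1 m1 where grow: "runs fGROW (vtree C u v m [(k, m)] [] [0..<n]) (vstate u1 v1 m1) (n * t_step)"
    and post: "stage_inv n C (Suc k) u1 v1 m1" "sized n (4 ^ n * M) C u1 v1" "\<forall>x\<in>set m1. - 1 \<le> x"
    using runs_grow[OF tree_inv_init[OF Suc.prems(1) kn] Suc.prems(2,3)] pw(1) n Suc.prems(5) by auto
  obtain u' v' m' where rec: "runs fSTAGES (VCons (encl vnat [Suc k..<n]) (VCons (encl (encl VInt) C)
      (VCons (encl vnat [0..<n]) (vstate u1 v1 m1)))) (encl VInt m') ((n - Suc k) * t_stage + unit_time)"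
    and fin: "stage_inv n C n u' v' m'"
  proof -
    have "d = n - Suc k" "0 \<le> 4 ^ n * M" "Suc k \<le> n" using Suc.hyps(2) Suc.prems(3) kn by auto
    from Suc.hyps(1)[OF this(1) post(1,2) this(2) pw(2) post(3) this(3)] that show thesis by blast
  qed
  have cons: "encl vnat [k..<n] = VCons (vnat k) (encl vnat [Suc k..<n])"
    using kn by (simp add: upt_conv_Cons)
  have grow': "runs fGROW (VCons (encl (encl VInt) C) (VCons (encl VInt u) (VCons (encl VInt v)
     (VCons (encl VInt m) (VCons (VCons (VCons (vnat k) (encl VInt m)) VNil) (VCons VNil (encl vnat [0..<n])))))))
     (vstate u1 v1 m1) (n * t_step)"
    using grow unfolding list.map enc_list.simps fst_conv snd_conv .
  have "n * t_step \<le> N * t_step" using n by simp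
  moreover have "(n - k) * t_stage = t_stage + (n - Suc k) * t_stage"
    using kn by (metis Suc_diff_Suc mult_Suc)
  ultimately have time: "x \<le> (n - k) * t_stage + unit_time"
    if "x \<le> n * t_step + (n - Suc k) * t_stage + 2 * unit_time" for x
    using that t_stage_def by linarith
  have "runs fSTAGES (VCons (encl vnat [k..<n]) (VCons (encl (encl VInt) C)
      (VCons (encl vnat [0..<n]) (vstate u v m)))) (encl VInt m') ((n - k) * t_stage + unit_time)"
    apply (rule runsI, unfold stages_body_def cons tup_simps)
    apply (rule within_mono)
     apply (rule within_case_cons)
      apply (rule ev_rules grow' rec)+
    apply (rule time)
    apply (simp add: unit_time_def)
    done
  then show ?case using fin by blast
qed

end

section \<open>Integral costs\<close>

definition num :: "rat \<Rightarrow> int" where "num r = fst (quotient_of r)"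
definition den :: "rat \<Rightarrow> int" where "den r = snd (quotient_of r)"

lemma enc_rat_eq: "enc_rat r = VCons (VInt (num r)) (VInt (den r))"
  by (simp add: enc_rat_def num_def den_def split: prod.split)

lemma den_pos: "0 < den r"
  unfolding den_def by (rule quotient_of_denom_pos')

abbreviation vsc :: "rat \<times> rat list \<Rightarrow> val" where
  "vsc s \<equiv> VCons (enc_rat (fst s)) (encl enc_rat (snd s))"

definition dens :: "rat list \<Rightarrow> int" where
  "dens rs = (\<Prod>r\<leftarrow>rs. den r)"

lemma dens_pos: "0 < dens rs"
  by (induction rs) (auto simp: dens_def den_pos)

lemma prod_dens_pos: "0 < (\<Prod>rs\<leftarrow>rss. dens rs)"
  by (induction rss) (auto simp: dens_pos)

text \<open>The integer \<open>D * r\<close> whenever \<open>den r\<close> divides \<open>D\<close>;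
  the division comes first, so it is exact.\<close>

definition scaled :: "int \<Rightarrow> rat \<Rightarrow> int" where
  "scaled D r = num r * (D div den r)"

text \<open>If \<open>pen\<close> is \<open>\<kappa>\<close> times the true penalty, this is
  \<open>D * \<kappa>\<close> times the expected penalty of job \<open>j\<close> at position
  \<open>t\<close>.\<close>

definition penalty_sum ::
  "(rat \<Rightarrow> nat \<Rightarrow> int \<Rightarrow> int) \<Rightarrow> int \<Rightarrow> (rat \<times> rat list) list \<Rightarrow> nat \<Rightarrow> nat \<Rightarrow> int" where
  "penalty_sum pen D sc j t = (\<Sum>s\<leftarrow>sc. scaled D (fst s) * pen (snd s ! j) t D)"

text \<open>Rows are jobs and columns are positions. The job counter \<open>j\<close> mirrors the
  recursion of \<open>mat_body\<close>.\<close>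

primrec cost_matrix ::
  "(rat \<Rightarrow> nat \<Rightarrow> int \<Rightarrow> int) \<Rightarrow> int \<Rightarrow> (rat \<times> rat list) list \<Rightarrow> nat list \<Rightarrow> nat \<Rightarrow> rat list \<Rightarrow> int list list"
where
  "cost_matrix pen D sc ts j [] = []"
| "cost_matrix pen D sc ts j (w # ws) =
    map (\<lambda>t. scaled D w * penalty_sum pen D sc j t) ts # cost_matrix pen D sc ts (Suc j) ws"

lemma length_cost_matrix [simp]: "length (cost_matrix pen D sc ts j ws) = length ws"
  by (induction ws arbitrary: j) auto

lemma cost_matrix_nth:
  "i < length ws \<Longrightarrow> cost_matrix pen D sc ts j ws ! i =
    map (\<lambda>t. scaled D (ws ! i) * penalty_sum pen D sc (j + i) t) ts"
  by (induction ws arbitrary: j i) (auto simp: nth_Cons' split: nat.split)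

definition good_rat :: "int \<Rightarrow> rat \<Rightarrow> bool" where
  "good_rat Y r \<longleftrightarrow> 0 \<le> num r \<and> num r \<le> Y \<and> den r \<le> Y"

lemma good_rat_div:
  assumes "good_rat Y r" "0 < D" "D \<le> Y"
  shows "0 \<le> D div den r" "D div den r \<le> Y"
proof -
  show "0 \<le> D div den r" using assms den_pos[of r] by (simp add: pos_imp_zdiv_nonneg_iff)
  have "D div den r \<le> D" using assms den_pos[of r] zdiv_mono2[of D 1 "den r"] by simp
  then show "D div den r \<le> Y" using assms by simp
qed

lemma good_rat_scaled:
  assumes "good_rat Y r" "0 < D" "D \<le> Y"
  shows "0 \<le> scaled D r" "scaled D r \<le> Y ^ 2"
proof -
  note d = good_rat_div[OF assms]
  show "0 \<le> scaled D r" using d assms unfolding scaled_def good_rat_def by simp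
  have "num r * (D div den r) \<le> Y * Y"
    using d assms unfolding good_rat_def by (intro mult_mono) auto
  then show "scaled D r \<le> Y ^ 2" unfolding scaled_def by (simp add: power2_eq_square)
qed

text \<open>\<open>Y\<close> bounds the input numbers and \<open>D\<close>, and exceeds
  \<open>N\<close>. A scaled rational and a penalty are at most \<open>Y ^ 2\<close>, a scenario
  term at most \<open>Y ^ 4\<close>, the sum over at most \<open>N\<close> scenarios at most
  \<open>Y ^ 5\<close>, and a matrix entry, after multiplication by the scaled weight, at most
  \<open>Y ^ 7\<close>.\<close>

locale cost_machine = machine +
  fixes Y D :: int and pen :: "rat \<Rightarrow> nat \<Rightarrow> int \<Rightarrow> int"
  assumes Y: "int N + 1 \<le> Y" "Y ^ 7 \<le> X" and D: "0 < D" "D \<le> Y"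
    and pen_runs: "\<And>r t. good_rat Y r \<Longrightarrow> t < N \<Longrightarrow>
      runs fPEN (VCons (enc_rat r) (VCons (vnat t) (VInt D))) (VInt (pen r t D)) unit_time"
    and pen_bounds: "\<And>r t. good_rat Y r \<Longrightarrow> t < N \<Longrightarrow> 0 \<le> pen r t D \<and> pen r t D \<le> Y ^ 2"
begin

lemma Y_power: "i \<le> 7 \<Longrightarrow> Y ^ i \<le> X"
  using Y power_increasing[of i 7 Y] by linarith

lemma le_Y_X: "0 \<le> x \<Longrightarrow> x \<le> Y \<Longrightarrow> \<bar>x\<bar> \<le> X"
  using Y_power[of 1] by simp

lemma le_Y_power_X: "0 \<le> x \<Longrightarrow> x \<le> Y ^ i \<Longrightarrow> i \<le> 7 \<Longrightarrow> \<bar>x\<bar> \<le> X"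
  using Y_power[of i] by simp

abbreviation psum where "psum \<equiv> penalty_sum pen D"

definition good_scens :: "nat \<Rightarrow> (rat \<times> rat list) list \<Rightarrow> bool" where
  "good_scens n sc \<longleftrightarrow> (\<forall>s\<in>set sc. good_rat Y (fst s) \<and> length (snd s) = n \<and> (\<forall>r\<in>set (snd s). good_rat Y r))"

lemma term_bounds:
  assumes "good_rat Y p" "good_rat Y r" "t < N"
  shows "0 \<le> scaled D p * pen r t D" "scaled D p * pen r t D \<le> Y ^ 4"
proof -
  note s = good_rat_scaled[OF assms(1) D] and p = pen_bounds[OF assms(2,3)]
  show "0 \<le> scaled D p * pen r t D" using s p by simp
  have "scaled D p * pen r t D \<le> Y ^ 2 * Y ^ 2" using s p by (intro mult_mono) auto
  then show "scaled D p * pen r t D \<le> Y ^ 4" by (simp flip: power_add)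
qed

lemma psum_bounds_aux:
  assumes "good_scens n sc" "j < n" "t < N"
  shows "0 \<le> psum sc j t \<and> psum sc j t \<le> int (length sc) * Y ^ 4"
  using assms(1)
proof (induction sc)
  case (Cons s sc)
  have "good_rat Y (fst s)" "good_rat Y (snd s ! j)"
    using Cons.prems assms(2) unfolding good_scens_def by auto
  note b = term_bounds[OF this assms(3)]
  have "0 \<le> psum sc j t \<and> psum sc j t \<le> int (length sc) * Y ^ 4"
    by (rule Cons.IH) (use Cons.prems in \<open>auto simp: good_scens_def\<close>)
  then show ?case using b unfolding penalty_sum_def by (simp add: algebra_simps)
qed (simp add: penalty_sum_def)

lemma psum_bounds:
  assumes "good_scens n sc" "j < n" "t < N" "length sc \<le> N"
  shows "0 \<le> psum sc j t" "psum sc j t \<le> Y ^ 5"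
proof -
  note b = psum_bounds_aux[OF assms(1-3)]
  show "0 \<le> psum sc j t" using b by blast
  have "int (length sc) * Y ^ 4 \<le> Y * Y ^ 4" using assms(4) Y by (intro mult_right_mono) auto
  then show "psum sc j t \<le> Y ^ 5" using b by (simp add: numeral_eq_Suc)
qed

definition t_entry where "t_entry = N * (t_nth + 3 * unit_time) + unit_time"

lemma runs_entry_aux:
  assumes "good_scens n sc" "j < n" "t < N" "length sc \<le> N" "n \<le> N"
  shows "runs fENTRY (VCons (encl vsc sc) (VCons (vnat j) (VCons (vnat t) (VInt D))))
    (VInt (psum sc j t)) (length sc * (t_nth + 3 * unit_time) + unit_time)"
  using assms(1,4)
proof (induction sc)
  case Nil
  show ?case
    apply (rule runsI, unfold entry_body_def list.map(1) enc_list.simps(1) tup_simps)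
    apply (rule within_conv)
      apply (rule within_case_nil)
       apply (rule ev_rules)+
     apply (auto simp: unit_time_def penalty_sum_def)
    done
next
  case (Cons s sc)
  obtain p d where s: "s = (p, d)" by (cases s)
  have g: "good_rat Y p" "good_rat Y (d ! j)" "length d = n" and gsc: "good_scens n sc"
    using Cons.prems assms(2) unfolding good_scens_def s by auto
  have IH: "runs fENTRY (VCons (encl vsc sc) (VCons (vnat j) (VCons (vnat t) (VInt D))))
    (VInt (psum sc j t)) (length sc * (t_nth + 3 * unit_time) + unit_time)"
    by (rule Cons.IH[OF gsc]) (use Cons.prems in simp)
  have nth: "runs fNTH (VCons (encl enc_rat d) (vnat j)) (enc_rat (d ! j)) t_nth"
    by (rule runs_nth) (use g assms in auto)
  have pn: "runs fPEN (VCons (enc_rat (d ! j)) (VCons (vnat t) (VInt D))) (VInt (pen (d ! j) t D)) unit_time"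
    by (rule pen_runs[OF g(2) assms(3)])
  have "\<bar>num p\<bar> \<le> X" "\<bar>den p\<bar> \<le> X" "\<bar>D\<bar> \<le> X" "\<bar>D div den p\<bar> \<le> X"
    using g(1) D den_pos[of p] good_rat_div[OF g(1) D] le_Y_X[of "num p"] le_Y_X[of "den p"]
      le_Y_X[of D] le_Y_X[of "D div den p"]
    by (auto simp: good_rat_def)
  moreover have "\<bar>num p * (D div den p)\<bar> \<le> X"
    using le_Y_power_X[OF good_rat_scaled[OF g(1) D]] unfolding scaled_def by simp
  moreover have "\<bar>pen (d ! j) t D\<bar> \<le> X"
    using pen_bounds[OF g(2) assms(3)] le_Y_power_X[of "pen (d ! j) t D" 2] by simp
  moreover have "\<bar>num p * (D div den p) * pen (d ! j) t D\<bar> \<le> X"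
    using le_Y_power_X[OF term_bounds[OF g(1,2) assms(3)]] unfolding scaled_def by simp
  moreover have "\<bar>psum sc j t\<bar> \<le> X"
    using psum_bounds[OF gsc assms(2,3)] Cons.prems le_Y_power_X[of "psum sc j t" 5] by simp
  ultimately have X: "\<bar>num p\<bar> \<le> X" "\<bar>den p\<bar> \<le> X" "\<bar>D\<bar> \<le> X" "\<bar>D div den p\<bar> \<le> X"
    "\<bar>num p * (D div den p)\<bar> \<le> X" "\<bar>pen (d ! j) t D\<bar> \<le> X"
    "\<bar>num p * (D div den p) * pen (d ! j) t D\<bar> \<le> X" "\<bar>psum sc j t\<bar> \<le> X" by blast+
  show ?case
    apply (rule runsI, unfold entry_body_def list.map(2) enc_list.simps(2) tup_simps s fst_conv snd_conv)
    apply (rule within_conv)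
      apply (rule within_case_cons)
       apply (rule ev_core ev_if_less within_fst_eq within_snd_eq refl enc_rat_eq X IH nth pn)+
     apply (simp add: penalty_sum_def scaled_def)
    apply (simp add: unit_time_def)
    done
qed

lemma runs_entry:
  assumes "good_scens n sc" "j < n" "t < N" "length sc \<le> N" "n \<le> N"
  shows "runs fENTRY (VCons (encl vsc sc) (VCons (vnat j) (VCons (vnat t) (VInt D)))) (VInt (psum sc j t)) t_entry"
  by (rule runs_mono[OF runs_entry_aux[OF assms]]) (auto simp: t_entry_def intro!: mult_le_mono1 assms)

definition t_row where "t_row = N * (t_entry + unit_time) + unit_time"

lemma runs_row_aux:
  assumes "good_scens n sc" "j < n" "length sc \<le> N" "n \<le> N" "0 \<le> W" "W \<le> Y ^ 2" "\<forall>t\<in>set ts. t < N"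
  shows "runs fROW (VCons (encl vnat ts) (VCons (VInt W) (VCons (vnat j) (VCons (VInt D) (encl vsc sc)))))
    (encl VInt (map (\<lambda>t. W * psum sc j t) ts)) (length ts * (t_entry + unit_time) + unit_time)"
  using assms(7)
proof (induction ts)
  case Nil
  show ?case
    apply (rule runsI, unfold row_body_def list.map(1) enc_list.simps(1) tup_simps)
    apply (rule within_conv)
      apply (rule within_case_nil)
       apply (rule ev_rules)+
     apply (auto simp: unit_time_def)
    done
next
  case (Cons t ts)
  have IH: "runs fROW (VCons (encl vnat ts) (VCons (VInt W) (VCons (vnat j) (VCons (VInt D) (encl vsc sc)))))
    (encl VInt (map (\<lambda>t. W * psum sc j t) ts)) (length ts * (t_entry + unit_time) + unit_time)"
    using Cons by simp
  have t: "t < N" using Cons.prems by simp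
  have en: "runs fENTRY (VCons (encl vsc sc) (VCons (vnat j) (VCons (vnat t) (VInt D)))) (VInt (psum sc j t)) t_entry"
    by (rule runs_entry[OF assms(1,2) t assms(3,4)])
  have X: "\<bar>W\<bar> \<le> X" "\<bar>psum sc j t\<bar> \<le> X"
    using psum_bounds[OF assms(1,2) t assms(3)] assms(5,6)
      le_Y_power_X[of "psum sc j t" 5] le_Y_power_X[of W 2] by simp_all
  show ?case
    apply (rule runsI, unfold row_body_def list.map(2) enc_list.simps(2) tup_simps)
    apply (rule within_conv)
      apply (rule within_case_cons)
       apply (rule ev_rules X IH en)+
     apply simp
    apply (simp add: unit_time_def)
    done
qed

lemma runs_row:
  assumes "good_scens n sc" "j < n" "length sc \<le> N" "n \<le> N" "0 \<le> W" "W \<le> Y ^ 2" "\<forall>t\<in>set ts. t < N"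
    "length ts \<le> N"
  shows "runs fROW (VCons (encl vnat ts) (VCons (VInt W) (VCons (vnat j) (VCons (VInt D) (encl vsc sc)))))
    (encl VInt (map (\<lambda>t. W * psum sc j t) ts)) t_row"
  by (rule runs_mono[OF runs_row_aux[OF assms(1-7)]]) (auto simp: t_row_def intro!: mult_le_mono1 assms)

definition t_mat where "t_mat = N * (t_row + unit_time) + unit_time"

lemma runs_mat_aux:
  assumes "good_scens n sc" "length sc \<le> N" "n \<le> N" "\<forall>t\<in>set ts. t < N" "length ts \<le> N"
    "j + length ws = n" "\<forall>w\<in>set ws. good_rat Y w"
  shows "runs fMAT (VCons (encl enc_rat ws) (VCons (vnat j) (VCons (encl vnat ts) (VCons (VInt D) (encl vsc sc)))))
    (encl (encl VInt) (cost_matrix pen D sc ts j ws)) (length ws * (t_row + unit_time) + unit_time)"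
  using assms(6,7)
proof (induction ws arbitrary: j)
  case Nil
  show ?case
    apply (rule runsI, unfold mat_body_def list.map(1) enc_list.simps(1) tup_simps)
    apply (rule within_conv)
      apply (rule within_case_nil)
       apply (rule ev_rules)+
     apply (auto simp: unit_time_def)
    done
next
  case (Cons w ws)
  have "int (Suc j) = int j + 1" by simp
  moreover have "runs fMAT (VCons (encl enc_rat ws) (VCons (vnat (Suc j)) (VCons (encl vnat ts) (VCons (VInt D) (encl vsc sc)))))
    (encl (encl VInt) (cost_matrix pen D sc ts (Suc j) ws)) (length ws * (t_row + unit_time) + unit_time)"
    by (rule Cons.IH) (use Cons.prems in auto)
  ultimately have IH: "runs fMAT (VCons (encl enc_rat ws) (VCons (VInt (int j + 1)) (VCons (encl vnat ts) (VCons (VInt D) (encl vsc sc)))))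
    (encl (encl VInt) (cost_matrix pen D sc ts (Suc j) ws)) (length ws * (t_row + unit_time) + unit_time)"
    by (simp only:)
  have g: "good_rat Y w" and j: "j < n" using Cons.prems by auto
  note sc = good_rat_scaled[OF g D, unfolded scaled_def]
  have row: "runs fROW (VCons (encl vnat ts) (VCons (VInt (num w * (D div den w)))
      (VCons (vnat j) (VCons (VInt D) (encl vsc sc)))))
    (encl VInt (map (\<lambda>t. num w * (D div den w) * psum sc j t) ts)) t_row"
    by (rule runs_row[OF assms(1) j assms(2,3) sc assms(4,5)])
  have "\<bar>num w\<bar> \<le> X" "\<bar>den w\<bar> \<le> X" "\<bar>D\<bar> \<le> X" "\<bar>D div den w\<bar> \<le> X"
    using g D den_pos[of w] good_rat_div[OF g D] le_Y_X[of "num w"] le_Y_X[of "den w"]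
      le_Y_X[of D] le_Y_X[of "D div den w"]
    by (auto simp: good_rat_def)
  moreover have "\<bar>int j\<bar> \<le> X" "\<bar>1 :: int\<bar> \<le> X" using j assms(3) N_le_X by auto
  ultimately have X: "\<bar>num w\<bar> \<le> X" "\<bar>den w\<bar> \<le> X" "\<bar>D\<bar> \<le> X" "\<bar>D div den w\<bar> \<le> X"
    "\<bar>int j\<bar> \<le> X" "\<bar>1 :: int\<bar> \<le> X" by blast+
  show ?case
    apply (rule runsI, unfold mat_body_def list.map(2) enc_list.simps(2) tup_simps)
    apply (rule within_conv)
      apply (rule within_case_cons)
       apply (rule ev_core within_fst_eq within_snd_eq refl enc_rat_eq X IH row)+
     apply (simp add: scaled_def)
    apply (simp add: unit_time_def)
    done
qed

section \<open>Index lists, constant lists and the common denominator\<close>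

lemma runs_upto:
  assumes "i + length ws \<le> N"
  shows "runs fUPTO (VCons (encl f ws) (vnat i)) (encl vnat [i..<i + length ws])
    (length ws * unit_time + unit_time)"
  using assms
proof (induction ws arbitrary: i)
  case Nil
  show ?case
    apply (rule runsI, unfold upto_body_def list.map(1) enc_list.simps(1))
    apply (rule within_conv)
      apply (rule within_case_nil)
       apply (rule ev_rules)+
     apply (auto simp: unit_time_def)
    done
next
  case (Cons w ws)
  have "int (Suc i) = int i + 1" by simp
  moreover have "runs fUPTO (VCons (encl f ws) (vnat (Suc i))) (encl vnat [Suc i..<Suc i + length ws])
    (length ws * unit_time + unit_time)"
    by (rule Cons.IH) (use Cons.prems in auto)
  ultimately have IH: "runs fUPTO (VCons (encl f ws) (VInt (int i + 1))) (encl vnat [Suc i..<Suc i + length ws])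
    (length ws * unit_time + unit_time)"
    by (simp only:)
  have X: "\<bar>int i\<bar> \<le> X" "\<bar>1 :: int\<bar> \<le> X" using Cons.prems N_le_X by auto
  show ?case
    apply (rule runsI, unfold upto_body_def list.map(2) enc_list.simps(2))
    apply (rule within_conv)
      apply (rule within_case_cons)
       apply (rule ev_rules X IH)+
     apply (simp add: upt_conv_Cons del: upt.simps)
    apply (simp add: unit_time_def)
    done
qed

lemma runs_const:
  "runs fCONST (VCons (encl f ws) (VInt c)) (encl VInt (replicate (length ws) c))
    (length ws * unit_time + unit_time)"
proof (induction ws)
  case Nil
  show ?case
    apply (rule runsI, unfold const_body_def list.map(1) enc_list.simps(1))
    apply (rule within_conv)
      apply (rule within_case_nil)
       apply (rule ev_rules)+
     apply (auto simp: unit_time_def)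
    done
next
  case (Cons w ws)
  show ?case
    apply (rule runsI, unfold const_body_def list.map(2) enc_list.simps(2))
    apply (rule within_conv)
      apply (rule within_case_cons)
       apply (rule ev_rules Cons.IH)+
     apply simp
    apply (simp add: unit_time_def)
    done
qed

lemma runs_dens:
  assumes "dens rs \<le> X"
  shows "runs fDENS (encl enc_rat rs) (VInt (dens rs)) (length rs * unit_time + unit_time)"
  using assms
proof (induction rs)
  case Nil
  show ?case
    apply (rule runsI, unfold dens_body_def list.map(1) enc_list.simps(1))
    apply (rule within_conv)
      apply (rule within_case_nil)
       apply (rule ev_rules)+
     apply (auto simp: unit_time_def dens_def)
    done
next
  case (Cons r rs)
  have eq: "dens (r # rs) = den r * dens rs" by (simp add: dens_def)
  \<comment> \<open>All factors are at least 1, so partial products never exceed the full product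
    and remain admissible operands.\<close>
  have "1 \<le> den r" "1 \<le> dens rs" using den_pos[of r] dens_pos[of rs] by simp_all
  then have "den r * 1 \<le> den r * dens rs" "1 * dens rs \<le> den r * dens rs"
    by (simp_all add: mult_right_mono del: mult_1)
  then have "den r \<le> X" "dens rs \<le> X" using Cons.prems eq by simp_all
  then have X: "\<bar>den r\<bar> \<le> X" "\<bar>dens rs\<bar> \<le> X" using den_pos[of r] dens_pos[of rs] by simp_all
  note IH = Cons.IH[OF \<open>dens rs \<le> X\<close>]
  show ?case
    apply (rule runsI, unfold dens_body_def list.map(2) enc_list.simps(2))
    apply (rule within_conv)
      apply (rule within_case_cons)
       apply (rule ev_core within_fst_eq within_snd_eq refl enc_rat_eq X IH)+
     apply (simp add: eq)
    apply (simp add: unit_time_def)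
    done
qed

text \<open>Read as a list, a scenario has its probability in front of the due dates, hence up to
  \<open>N + 1\<close> entries.\<close>

definition t_dens where "t_dens = N * unit_time + 3 * unit_time"

lemma runs_all_dens:
  assumes "(\<Prod>rs\<leftarrow>rss. dens rs) \<le> X" "\<forall>rs\<in>set rss. length rs \<le> N + 1"
  shows "runs fALLDENS (encl (encl enc_rat) rss) (VInt (\<Prod>rs\<leftarrow>rss. dens rs)) (length rss * t_dens + unit_time)"
  using assms
proof (induction rss)
  case Nil
  show ?case
    apply (rule runsI, unfold all_dens_body_def list.map(1) enc_list.simps(1))
    apply (rule within_conv)
      apply (rule within_case_nil)
       apply (rule ev_rules)+
     apply (auto simp: unit_time_def)
    done
next
  case (Cons rs rss)
  let ?p = "\<Prod>rs\<leftarrow>rss. dens rs"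
  have "1 \<le> dens rs" "1 \<le> ?p" using dens_pos[of rs] prod_dens_pos[of rss] by simp_all
  then have "dens rs * 1 \<le> dens rs * ?p" "1 * ?p \<le> dens rs * ?p"
    by (simp_all add: mult_right_mono del: mult_1)
  then have le: "dens rs \<le> X" "?p \<le> X" using Cons.prems by simp_all
  then have X: "\<bar>dens rs\<bar> \<le> X" "\<bar>?p\<bar> \<le> X" using dens_pos[of rs] prod_dens_pos[of rss] by simp_all
  have IH: "runs fALLDENS (encl (encl enc_rat) rss) (VInt ?p) (length rss * t_dens + unit_time)"
    using Cons le by simp
  have "length rs * unit_time \<le> (N + 1) * unit_time" using Cons.prems by (intro mult_le_mono1) simp
  then have time: "length rs * unit_time \<le> N * unit_time + unit_time" by simp
  show ?case
    apply (rule runsI, unfold all_dens_body_def list.map(2) enc_list.simps(2))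
    apply (rule within_conv)
      apply (rule within_case_cons)
       apply (rule ev_rules X IH runs_dens[OF le(1)])+
     apply simp
    using time apply (simp add: t_dens_def unit_time_def)
    done
qed

definition t_main where
  "t_main = N * t_dens + N * t_stage + t_mat + 4 * (N * unit_time) + 8 * unit_time"

lemma runs_main:
  fixes ws sc
  defines "n \<equiv> length ws"
  assumes "good_scens n sc" "Suc (length sc) \<le> N" "n \<le> N" "\<forall>w\<in>set ws. good_rat Y w"
    "D = dens ws * (\<Prod>s\<leftarrow>sc. dens (fst s # snd s))" "4 ^ Suc (n * n) * Y ^ 7 \<le> X"
  obtains \<pi> where "runs fMAIN (VCons (encl enc_rat ws) (encl vsc sc)) (encl vnat \<pi>) t_main"
    "\<pi> \<in> permutations_of_set {..<n}"
    "\<And>\<pi>'. \<pi>' \<in> permutations_of_set {..<n} \<Longrightarrow>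
      (\<Sum>t<n. scaled D (ws ! (\<pi> ! t)) * psum sc (\<pi> ! t) t) \<le>
      (\<Sum>t<n. scaled D (ws ! (\<pi>' ! t)) * psum sc (\<pi>' ! t) t)"
proof -
  define C where "C = cost_matrix pen D sc [0..<n] 0 ws"
  have lC: "length C = n" by (simp add: C_def n_def)
  have Cn: "C ! j ! t = scaled D (ws ! j) * psum sc j t" "length (C ! j) = n" if "j < n" "t < n" for j t
    using that cost_matrix_nth[of j ws pen D sc "[0..<n]" 0] by (auto simp: C_def n_def)
  have Cb: "0 \<le> C ! j ! t \<and> C ! j ! t \<le> Y ^ 7" if "j < n" "t < n" for j t
  proof -
    have g: "good_rat Y (ws ! j)" using assms that by auto
    note b = good_rat_scaled[OF g D] psum_bounds[OF assms(2) that(1), of t]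
    have "scaled D (ws ! j) * psum sc j t \<le> Y ^ 2 * Y ^ 5" using b that assms by (intro mult_mono) auto
    then show ?thesis using b that assms Cn by (simp flip: power_add)
  qed
  have Y0: "0 \<le> Y ^ 7" using Y by (intro zero_le_power) linarith
  let ?z = "replicate n (0 :: int)" and ?m = "replicate n (- 1 :: int)"
  \<comment> \<open>Zero prices are feasible because all matrix entries are nonnegative; -1 marks
    every position as free.\<close>
  have si: "stage_inv n C 0 ?z ?z ?m"
    using Cb unfolding stage_inv_def feasible_def tight_duals_def jobs_def by auto
  have sz: "sized n (Y ^ 7) C ?z ?z"
    using Cb Cn lC assms Y0 unfolding sized_def by fastforce
  obtain u v m where st: "runs fSTAGES (VCons (encl vnat [0..<n]) (VCons (encl (encl VInt) C)
      (VCons (encl vnat [0..<n]) (vstate ?z ?z ?m)))) (encl VInt m) (n * t_stage + unit_time)"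
    and fin: "stage_inv n C n u v m"
    using runs_stages[OF si sz Y0] assms(7) by auto
  obtain \<pi> where m: "m = map int \<pi>" and \<pi>: "\<pi> \<in> permutations_of_set {..<n}"
    using stage_inv_schedule[OF fin] .
  have lt: "\<pi> ! t < n" if "t < n" "\<pi> \<in> permutations_of_set {..<n}" for \<pi> t
    using that nth_mem[of t \<pi>] permutations_of_setD(1)[OF that(2)]
    by (auto simp: length_finite_permutations_of_set)
  have opt: "(\<Sum>t<n. scaled D (ws ! (\<pi> ! t)) * psum sc (\<pi> ! t) t) \<le>
      (\<Sum>t<n. scaled D (ws ! (\<pi>' ! t)) * psum sc (\<pi>' ! t) t)"
    if "\<pi>' \<in> permutations_of_set {..<n}" for \<pi>'
    using stage_inv_optimal[OF fin[unfolded m] \<pi> that] lt[OF _ \<pi>] lt[OF _ that] Cn by simp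
  have st': "runs fSTAGES (VCons (encl vnat [0..<n]) (VCons (encl (encl VInt) C)
      (VCons (encl vnat [0..<n]) (vstate ?z ?z ?m)))) (encl vnat \<pi>) (n * t_stage + unit_time)"
    using st unfolding m by (simp add: comp_def)
  have up: "runs fUPTO (VCons (encl enc_rat ws) (VInt 0)) (encl vnat [0..<n]) (n * unit_time + unit_time)"
    using runs_upto[of 0 ws enc_rat] assms by (simp add: n_def)
  have cz: "runs fCONST (VCons (encl enc_rat ws) (VInt 0)) (encl VInt ?z) (n * unit_time + unit_time)"
    and cm: "runs fCONST (VCons (encl enc_rat ws) (VInt (- 1))) (encl VInt ?m) (n * unit_time + unit_time)"
    using runs_const[of enc_rat ws] by (simp_all add: n_def)
  have mat: "runs fMAT (VCons (encl enc_rat ws) (VCons (VInt 0) (VCons (encl vnat [0..<n])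
      (VCons (VInt D) (encl vsc sc))))) (encl (encl VInt) C) (n * (t_row + unit_time) + unit_time)"
    using runs_mat_aux[OF assms(2) _ assms(4), of "[0..<n]" 0 ws] assms by (simp add: n_def C_def)
  let ?rss = "ws # map (\<lambda>s. fst s # snd s) sc"
  have Dp: "(\<Prod>rs\<leftarrow>?rss. dens rs) = D" using assms(6) by (simp add: comp_def)
  have enc: "encl (encl enc_rat) ?rss = VCons (encl enc_rat ws) (encl vsc sc)" by (simp add: comp_def)
  have "(\<Prod>rs\<leftarrow>?rss. dens rs) \<le> X" unfolding Dp using D le_Y_X[of D] by simp
  moreover have "\<forall>rs\<in>set ?rss. length rs \<le> N + 1"
    using assms unfolding good_scens_def n_def by auto
  ultimately have "runs fALLDENS (encl (encl enc_rat) ?rss) (VInt (\<Prod>rs\<leftarrow>?rss. dens rs))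
      (length ?rss * t_dens + unit_time)" by (rule runs_all_dens)
  then have pdd: "runs fALLDENS (VCons (encl enc_rat ws) (encl vsc sc)) (VInt D) (Suc (length sc) * t_dens + unit_time)"
    unfolding Dp enc by simp
  have time: "Suc (length sc) * t_dens \<le> N * t_dens" "n * t_stage \<le> N * t_stage"
    "n * unit_time \<le> N * unit_time" "n * (t_row + unit_time) \<le> N * (t_row + unit_time)"
    using assms by (intro mult_le_mono1; simp)+
  have time_unit: "100 \<le> unit_time" by (simp add: unit_time_def)
  have "runs fMAIN (VCons (encl enc_rat ws) (encl vsc sc)) (encl vnat \<pi>) t_main"
    apply (rule runsI, unfold main_body_def)
    apply (rule within_mono)
     apply (rule ev_rules up cz cm mat pdd st')+
    using time time_unit unfolding t_main_def t_mat_def apply linarith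
    done
  then show thesis using that \<pi> opt by blast
qed

end

section \<open>Approximation\<close>

text \<open>Positions are counted from 0, so the job at position \<open>t\<close> completes at time
  \<open>t + 1\<close>.\<close>

lemma completion_time_nth:
  assumes "\<pi> \<in> permutations_of_set {..<n}" "t < n"
  shows "completion_time \<pi> (\<pi> ! t) = t + 1"
proof -
  have "distinct \<pi>" "length \<pi> = n"
    using assms by (auto dest: permutations_of_setD simp: length_finite_permutations_of_set)
  then have "takeWhile (\<lambda>i. i \<noteq> \<pi> ! t) \<pi> = take t \<pi>"
    using assms(2) by (intro takeWhile_eq_take_P_nth) (auto simp: nth_eq_iff_index_eq)
  then show ?thesis using \<open>length \<pi> = n\<close> assms(2) by (simp add: completion_time_def)
qed

lemma rat_eq_num_den: "r = of_int (num r) / of_int (den r)"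
  using quotient_of_div[of r "num r" "den r"] by (simp add: num_def den_def)

lemma num_nonneg:
  assumes "0 \<le> r"
  shows "0 \<le> num r"
proof (rule ccontr)
  assume "\<not> ?thesis"
  then have "of_int (num r) / of_int (den r) < (0 :: rat)"
    using den_pos[of r] by (intro divide_neg_pos) auto
  then show False using assms rat_eq_num_den[of r] by simp
qed

lemma of_int_scaled:
  assumes "den r dvd D"
  shows "real_of_int (scaled D r) = of_int D * of_rat r"
proof -
  obtain k where k: "D = den r * k" using assms by blast
  have "(of_rat r :: real) = of_rat (of_int (num r) / of_int (den r))"
    using rat_eq_num_den[of r] by (rule arg_cong)
  also have "\<dots> = of_int (num r) / of_int (den r)" by (simp add: of_rat_divide)
  finally show ?thesis using k den_pos[of r] by (simp add: scaled_def)
qed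

lemma sum_list_sum_swap:
  fixes g :: "'a \<Rightarrow> 'b \<Rightarrow> real"
  shows "(\<Sum>x\<leftarrow>xs. \<Sum>j\<in>A. g x j) = (\<Sum>j\<in>A. \<Sum>x\<leftarrow>xs. g x j)"
  by (induction xs) (auto simp: sum.distrib)

lemma real_of_int_sum_list: "real_of_int (\<Sum>x\<leftarrow>xs. h x) = (\<Sum>x\<leftarrow>xs. real_of_int (h x))"
  by (induction xs) auto

text \<open>The sums over scenarios and jobs are interchanged and the jobs reindexed by position,
  which turns completion times into positions. One factor \<open>D\<close> clears the weight, the
  other the probability, and \<open>\<kappa>\<close> accounts for the penalty.\<close>

lemma expected_cost_eq_assignment:
  fixes g :: "nat \<Rightarrow> rat \<Rightarrow> real" and pen :: "rat \<Rightarrow> nat \<Rightarrow> int \<Rightarrow> int"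
  assumes f: "\<And>\<pi> d. f I \<pi> d = (\<Sum>j<num_jobs I. of_rat (weights I ! j) * g (completion_time \<pi> j) (d ! j))"
    and pen: "\<And>r t. den r dvd D \<Longrightarrow> real_of_int (pen r t D) = \<kappa> * g (t + 1) r"
    and w: "\<And>w. w \<in> set (weights I) \<Longrightarrow> den w dvd D"
    and sc: "\<And>p d. (p, d) \<in> set (scenarios I) \<Longrightarrow>
      den p dvd D \<and> length d = num_jobs I \<and> (\<forall>r\<in>set d. den r dvd D)"
    and \<pi>: "\<pi> \<in> schedules I"
  shows "real_of_int D * of_int D * \<kappa> * expected_cost f I \<pi> =
    of_int (\<Sum>t<num_jobs I. scaled D (weights I ! (\<pi> ! t)) * penalty_sum pen D (scenarios I) (\<pi> ! t) t)"
proof -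
  let ?n = "num_jobs I"
  have \<pi>: "\<pi> \<in> permutations_of_set {..<?n}" using \<pi> by (simp add: schedules_def)
  have lt: "\<pi> ! t < ?n" if "t < ?n" for t
    using that nth_mem[of t \<pi>] permutations_of_setD(1)[OF \<pi>] length_finite_permutations_of_set[OF \<pi>] by auto
  define h where "h j = of_rat (weights I ! j) *
    (\<Sum>s\<leftarrow>scenarios I. of_rat (fst s) * g (completion_time \<pi> j) (snd s ! j))" for j
  have "expected_cost f I \<pi> = (\<Sum>s\<leftarrow>scenarios I. \<Sum>j<?n.
      of_rat (weights I ! j) * (of_rat (fst s) * g (completion_time \<pi> j) (snd s ! j)))"
    unfolding expected_cost_def f case_prod_unfold sum_distrib_left
    by (simp add: mult.left_commute)
  also have "\<dots> = (\<Sum>j<?n. h j)"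
    unfolding sum_list_sum_swap h_def by (simp add: sum_list_const_mult)
  also have "\<dots> = (\<Sum>t<?n. h (\<pi> ! t))" by (rule sum_permutation[OF \<pi>, symmetric])
  finally have E: "expected_cost f I \<pi> = (\<Sum>t<?n. h (\<pi> ! t))" .
  have psum: "real_of_int (penalty_sum pen D (scenarios I) j t) =
      of_int D * \<kappa> * (\<Sum>s\<leftarrow>scenarios I. of_rat (fst s) * g (t + 1) (snd s ! j))" if "j < ?n" for j t
  proof -
    have "real_of_int (penalty_sum pen D (scenarios I) j t) =
        (\<Sum>s\<leftarrow>scenarios I. real_of_int (scaled D (fst s)) * of_int (pen (snd s ! j) t D))"
      unfolding penalty_sum_def real_of_int_sum_list by simp
    also have "\<dots> = (\<Sum>s\<leftarrow>scenarios I. of_int D * \<kappa> * (of_rat (fst s) * g (t + 1) (snd s ! j)))"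
    proof (rule arg_cong[of _ _ sum_list], rule map_cong[OF refl])
      fix s assume s: "s \<in> set (scenarios I)"
      have d: "den (fst s) dvd D" "den (snd s ! j) dvd D" using sc[of "fst s" "snd s"] s that by auto
      show "real_of_int (scaled D (fst s)) * of_int (pen (snd s ! j) t D) =
          of_int D * \<kappa> * (of_rat (fst s) * g (t + 1) (snd s ! j))"
        unfolding of_int_scaled[OF d(1)] pen[OF d(2)] by simp
    qed
    finally show ?thesis by (simp add: sum_list_const_mult)
  qed
  have "real_of_int (scaled D (weights I ! (\<pi> ! t)) * penalty_sum pen D (scenarios I) (\<pi> ! t) t) =
      of_int D * of_int D * \<kappa> * h (\<pi> ! t)" if "t < ?n" for t
  proof -
    have "den (weights I ! (\<pi> ! t)) dvd D" using w lt[OF that] by (simp add: num_jobs_def)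
    then show ?thesis
      unfolding of_int_mult psum[OF lt[OF that]] h_def completion_time_nth[OF \<pi> that]
      by (simp add: of_int_scaled)
  qed
  then show ?thesis unfolding E of_int_sum sum_distrib_left by simp
qed

section \<open>Encoding sizes against magnitudes of numbers\<close>

lemma abs_less_int_size: "\<bar>x\<bar> < 2 ^ int_size x"
proof -
  have "nat \<bar>x\<bar> < 2 ^ floorlog 2 (nat \<bar>x\<bar>)" by (rule floorlog_leD) auto
  also have "(2::nat) ^ floorlog 2 (nat \<bar>x\<bar>) \<le> 2 ^ int_size x"
    unfolding int_size_def by (intro power_increasing) auto
  finally have "int (nat \<bar>x\<bar>) < int (2 ^ int_size x)" by (simp only: of_nat_less_iff)
  then show ?thesis by simp
qed

lemma int_size_le:
  assumes "\<bar>x\<bar> \<le> 2 ^ e"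
  shows "int_size x \<le> e + 2"
proof -
  have "\<bar>x\<bar> < 2 ^ (e + 1)" using assms by (simp add: order_le_less_trans[of _ "2 ^ e"])
  then have "nat \<bar>x\<bar> < 2 ^ (e + 1)" by (simp add: nat_less_iff)
  then have "floorlog 2 (nat \<bar>x\<bar>) \<le> e + 1" by (intro floorlog_leI) auto
  then show ?thesis by (simp add: int_size_def)
qed

lemma val_size_pos: "0 < val_size v"
  by (cases v) (auto simp: int_size_def)

lemma length_less_val_size: "length xs < val_size (encl f xs)"
  by (induction xs) (auto simp: val_size_pos)

lemma val_size_elem: "x \<in> set xs \<Longrightarrow> val_size (f x) \<le> val_size (encl f xs)"
  by (induction xs) auto

lemma val_size_rat: "\<bar>num r\<bar> < 2 ^ val_size (enc_rat r)" "den r < 2 ^ val_size (enc_rat r)"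
proof -
  have "(2::int) ^ int_size (num r) \<le> 2 ^ val_size (enc_rat r)" "(2::int) ^ int_size (den r) \<le> 2 ^ val_size (enc_rat r)"
    unfolding enc_rat_eq by (intro power_increasing; simp)+
  then show "\<bar>num r\<bar> < 2 ^ val_size (enc_rat r)" "den r < 2 ^ val_size (enc_rat r)"
    using abs_less_int_size[of "num r"] abs_less_int_size[of "den r"] by linarith+
qed

text \<open>Encoding sizes add up along a list while the bounds multiply, so a product over the
  whole input has no more bits than the size of the input.\<close>

lemma prod_list_le_val_size:
  fixes h :: "'a \<Rightarrow> int"
  assumes "\<And>x. 0 < h x" "\<And>x. h x \<le> 2 ^ val_size (f x)"
  shows "(\<Prod>x\<leftarrow>xs. h x) \<le> 2 ^ val_size (encl f xs)"
proof (induction xs)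
  case (Cons x xs)
  have "0 \<le> (\<Prod>x\<leftarrow>xs. h x)" using assms(1) by (induction xs) (auto simp: less_imp_le)
  then have "h x * (\<Prod>x\<leftarrow>xs. h x) \<le> 2 ^ val_size (f x) * 2 ^ val_size (encl f xs)"
    using Cons assms by (intro mult_mono) auto
  also have "\<dots> \<le> 2 ^ val_size (encl f (x # xs))"
    by (simp flip: power_add)
  finally show ?case by simp
qed simp

lemma dens_le: "dens rs \<le> 2 ^ val_size (encl enc_rat rs)"
  unfolding dens_def by (rule prod_list_le_val_size) (auto simp: den_pos less_imp_le[OF val_size_rat(2)])

lemma prod_list_dvd: "x \<in> set xs \<Longrightarrow> h x dvd (\<Prod>x\<leftarrow>xs. h x :: int)"
  by (induction xs) auto

text \<open>The running time \<open>t_main\<close> as a polynomial in \<open>N\<close>, given the polynomial \<open>l\<close> for the bit length \<open>L\<close>.\<close>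

definition time_poly :: "nat poly \<Rightarrow> nat poly" where
  "time_poly l =
    (let x = [:0, 1:]; u = [:100:] + smult 20 l; nth = x * u; upd = x * u + u;
         add = x * (nth + upd + u) + u; rem = x * u + u; sl = smult 4 nth + u;
         scanc = x * (sl + u) + u; scanr = x * (scanc + u) + u;
         step = sl + scanr + smult 2 add + upd + nth + rem + smult 5 u;
         stage = x * step + u; entry = x * (nth + smult 3 u) + u;
         row = x * (entry + u) + u; mat = x * (row + u) + u; pd = x * u + smult 3 u
     in x * pd + x * stage + mat + smult 4 (x * u) + smult 8 u)"

lemma (in cost_machine) t_main_eq_poly:
  assumes "L = poly l N"
  shows "t_main = poly (time_poly l) N"
  unfolding time_poly_def Let_def t_main_def t_dens_def t_mat_def t_row_def t_entry_def t_stage_def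
    t_step_def t_scanr_def t_scanc_def t_slack_def t_rem_def t_add_def t_upd_def t_nth_def unit_time_def
  by (simp add: assms[symmetric] algebra_simps)

lemma enc_instance_eq: "enc_instance I = VCons (encl enc_rat (weights I)) (encl vsc (scenarios I))"
  by (simp add: enc_instance_def case_prod_unfold)

text \<open>The product of all denominators, those of due dates included, instead of their least
  common multiple: no gcd has to be computed, and the bit length is still linear in the input
  size.\<close>

definition common_den :: "sched_instance \<Rightarrow> int" where
  "common_den I = dens (weights I) * (\<Prod>s\<leftarrow>scenarios I. dens (fst s # snd s))"

text \<open>\<open>g\<close> is the penalty as a function of completion time and due date,
  \<open>pen\<close> its integer version scaled by \<open>\<kappa> D\<close>, and \<open>pe\<close>
  the code for \<open>pen\<close>. Only a run within one time unit and the bound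
  \<open>Y ^ 2\<close> are required of the latter two beyond the scaling.\<close>

lemma approximable_by_assignment:
  fixes g :: "nat \<Rightarrow> rat \<Rightarrow> real" and pen :: "rat \<Rightarrow> nat \<Rightarrow> int \<Rightarrow> int" and \<kappa> :: "int \<Rightarrow> real"
  assumes \<alpha>: "0 \<le> \<alpha>" "\<alpha> < 1"
    and f: "\<And>I \<pi> d. f I \<pi> d = (\<Sum>j<num_jobs I. of_rat (weights I ! j) * g (completion_time \<pi> j) (d ! j))"
    and g: "\<And>t r. 0 \<le> g t r"
    and pen: "\<And>r t D. 0 < D \<Longrightarrow> den r dvd D \<Longrightarrow> real_of_int (pen r t D) = \<kappa> D * g (t + 1) r"
    and \<kappa>: "\<And>D. 0 < D \<Longrightarrow> 0 < \<kappa> D"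
    and pen_bounds: "\<And>r t D Y N. good_rat Y r \<Longrightarrow> t < N \<Longrightarrow> int N + 1 \<le> Y \<Longrightarrow> 0 < D \<Longrightarrow> D \<le> Y \<Longrightarrow>
      0 \<le> pen r t D \<and> pen r t D \<le> Y ^ 2"
    and pen_runs: "\<And>X L N r t D Y. machine X L N \<Longrightarrow> good_rat Y r \<Longrightarrow> t < N \<Longrightarrow> int N + 1 \<le> Y \<Longrightarrow> 0 < D \<Longrightarrow> D \<le> Y \<Longrightarrow>
      Y ^ 2 \<le> X \<Longrightarrow>
      machine.runs pe fPEN (VCons (enc_rat r) (VCons (vnat t) (VInt D))) (VInt (pen r t D)) (machine.unit_time L)"
  shows "approximable_within sched_instances enc_instance schedules enc_schedule
    (\<lambda>I \<pi>. CVaR \<alpha> (random_cost f I \<pi>)) (\<lambda>I. min (1 / Pr_min I) (1 / (1 - \<alpha>)))"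
  unfolding approximable_within_def
proof (intro exI ballI)
  fix I assume I: "I \<in> sched_instances"
  let ?S = "val_size (enc_instance I)" and ?n = "num_jobs I"
  \<comment> \<open>\<open>X\<close> equals \<open>2 ^ (2 * S * S + 7 * S + 2)\<close>, and
    \<open>int_size_le\<close> adds 2 to the exponent.\<close>
  let ?l = "[:4, 7, 2:] :: nat poly"
  define S where "S = ?S"
  \<comment> \<open>The bound demanded by \<open>runs_main\<close> with \<open>Y = 2 ^ S\<close>,
    where the number of jobs is replaced by the larger input size \<open>S\<close>.\<close>
  define X where "X = 4 ^ Suc (S * S) * (2 ^ S :: int) ^ 7"
  define D where "D = common_den I"
  have w0: "0 \<le> w" if "w \<in> set (weights I)" for w using I that unfolding sched_instances_def by blast
  have sc0: "0 < p" "length d = ?n" "\<forall>r\<in>set d. 0 \<le> r" if "(p, d) \<in> set (scenarios I)" for p d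
    using I that unfolding sched_instances_def by blast+
  have S_eq: "S = 1 + val_size (encl enc_rat (weights I)) + val_size (encl vsc (scenarios I))"
    unfolding S_def enc_instance_eq by simp
  have good: "good_rat (2 ^ S) r" if "val_size (enc_rat r) \<le> S" "0 \<le> r" for r
  proof -
    have "(2::int) ^ val_size (enc_rat r) \<le> 2 ^ S" using that by (intro power_increasing) auto
    then show ?thesis using val_size_rat[of r] num_nonneg[OF that(2)] unfolding good_rat_def by linarith
  qed
  have good_w: "\<forall>w\<in>set (weights I). good_rat (2 ^ S) w"
  proof
    fix w assume w: "w \<in> set (weights I)"
    have "val_size (enc_rat w) \<le> S" using val_size_elem[OF w, of enc_rat] S_eq by linarith
    then show "good_rat (2 ^ S) w" using w0[OF w] by (rule good)
  qed
  have good_sc: "good_rat (2 ^ S) (fst s) \<and> length (snd s) = ?n \<and> (\<forall>r\<in>set (snd s). good_rat (2 ^ S) r)"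
    if "s \<in> set (scenarios I)" for s
  proof -
    have "val_size (vsc s) \<le> S" using val_size_elem[OF that, of vsc] S_eq by simp
    then have "val_size (enc_rat (fst s)) \<le> S" "val_size (encl enc_rat (snd s)) \<le> S" by auto
    then show ?thesis using sc0[of "fst s" "snd s"] that val_size_elem[of _ "snd s" enc_rat]
      by (auto intro!: good intro: order_trans less_imp_le)
  qed
  have D_pos: "0 < D"
    using dens_pos prod_dens_pos[of "map (\<lambda>s. fst s # snd s) (scenarios I)"]
    unfolding D_def common_den_def by (simp add: comp_def)
  have D_le: "D \<le> 2 ^ S"
  proof -
    have "(\<Prod>s\<leftarrow>scenarios I. dens (fst s # snd s)) \<le> 2 ^ val_size (encl vsc (scenarios I))"
      using dens_le dens_pos by (intro prod_list_le_val_size) (auto simp: dens_le[of "_ # _", simplified])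
    moreover have "0 \<le> (\<Prod>s\<leftarrow>scenarios I. dens (fst s # snd s))"
      using prod_dens_pos[of "map (\<lambda>s. fst s # snd s) (scenarios I)"] by (simp add: comp_def)
    ultimately have "D \<le> 2 ^ val_size (encl enc_rat (weights I)) * 2 ^ val_size (encl vsc (scenarios I))"
      unfolding D_def common_den_def using dens_le by (intro mult_mono) auto
    also have "\<dots> \<le> 2 ^ S" unfolding S_eq by (simp flip: power_add)
    finally show ?thesis .
  qed
  have Y: "int S + 1 \<le> 2 ^ S"
  proof -
    have "S < 2 ^ S" by (rule less_exp)
    then have "int (Suc S) \<le> int (2 ^ S)" by (simp only: of_nat_le_iff Suc_le_eq)
    then show ?thesis by simp
  qed
  have XY: "(2 ^ S) ^ 7 \<le> X"
  proof -
    have "1 \<le> (4 :: int) ^ Suc (S * S)" by (rule one_le_power) simp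
    then have "1 * (2 ^ S) ^ 7 \<le> X" unfolding X_def by (rule mult_right_mono) simp
    then show ?thesis by simp
  qed
  have X2: "X = 2 ^ (2 * S * S + 7 * S + 2)"
  proof -
    have "(4::int) ^ Suc (S * S) = 2 ^ (2 * Suc (S * S))" by (simp add: power_mult)
    then show ?thesis unfolding X_def by (simp flip: power_add power_mult add: algebra_simps)
  qed
  have "machine X (poly ?l S) S"
  proof
    show "int_size x \<le> poly ?l S" if "\<bar>x\<bar> \<le> X" for x
      using int_size_le[of x "2 * S * S + 7 * S + 2"] that unfolding X2 by (simp add: algebra_simps)
    have "(2 ^ S) ^ 1 \<le> ((2::int) ^ S) ^ 7" by (intro power_increasing) auto
    then show "int S + 1 \<le> X" using Y XY by simp
  qed
  then interpret machine pe X "poly ?l S" S .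
  have X2': "(2 ^ S) ^ 2 \<le> X"
  proof -
    have "((2::int) ^ S) ^ 2 \<le> (2 ^ S) ^ 7" by (intro power_increasing) auto
    then show ?thesis using XY by linarith
  qed
  interpret cost_machine pe X "poly ?l S" S "2 ^ S" D pen
  proof
    show "runs fPEN (VCons (enc_rat r) (VCons (vnat t) (VInt D))) (VInt (pen r t D)) unit_time"
      if "good_rat (2 ^ S) r" "t < S" for r t
      by (rule pen_runs[OF machine_axioms that Y D_pos D_le X2'])
    show "0 \<le> pen r t D \<and> pen r t D \<le> (2 ^ S) ^ 2" if "good_rat (2 ^ S) r" "t < S" for r t
      by (rule pen_bounds[OF that Y D_pos D_le])
  qed (use Y XY D_pos D_le in auto)
  have n: "length (weights I) = ?n" by (simp add: num_jobs_def)
  have nS: "?n \<le> S"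
    using length_less_val_size[of "weights I" enc_rat] S_eq n by simp
  have "4 ^ Suc (?n * ?n) * (2 ^ S) ^ 7 \<le> X"
    unfolding X_def using nS by (intro mult_right_mono power_increasing) (auto intro: mult_le_mono)
  moreover have "good_scens ?n (scenarios I)" using good_sc unfolding good_scens_def by blast
  moreover have "Suc (length (scenarios I)) \<le> S"
    using length_less_val_size[of "scenarios I" vsc] S_eq by linarith
  moreover have "D = dens (weights I) * (\<Prod>s\<leftarrow>scenarios I. dens (fst s # snd s))"
    by (simp only: D_def common_den_def)
  ultimately obtain \<pi> where run: "runs fMAIN (VCons (encl enc_rat (weights I)) (encl vsc (scenarios I))) (encl vnat \<pi>) t_main"
    and \<pi>: "\<pi> \<in> permutations_of_set {..<?n}"
    and opt: "\<And>\<pi>'. \<pi>' \<in> permutations_of_set {..<?n} \<Longrightarrow>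
      (\<Sum>t<?n. scaled D (weights I ! (\<pi> ! t)) * psum (scenarios I) (\<pi> ! t) t) \<le>
      (\<Sum>t<?n. scaled D (weights I ! (\<pi>' ! t)) * psum (scenarios I) (\<pi>' ! t) t)"
    using runs_main[of "weights I" "scenarios I", unfolded n] nS good_w by blast
  have dvd_w: "den w dvd D" if "w \<in> set (weights I)" for w
    using prod_list_dvd[OF that, of den] unfolding D_def common_den_def dens_def by (simp add: dvd_mult2)
  have dvd_sc: "den p dvd D \<and> length d = ?n \<and> (\<forall>r\<in>set d. den r dvd D)" if "(p, d) \<in> set (scenarios I)" for p d
  proof -
    have "dens (p # d) dvd D"
      using prod_list_dvd[OF that, of "\<lambda>s. dens (fst s # snd s)"] unfolding D_def common_den_def by simp
    moreover have "den r dvd dens (p # d)" if "r \<in> set (p # d)" for r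
      unfolding dens_def by (rule prod_list_dvd[OF that])
    ultimately show ?thesis using sc0(2)[OF that] by (auto intro: dvd_trans)
  qed
  have cost: "real_of_int D * of_int D * \<kappa> D * expected_cost f I \<pi>' =
      of_int (\<Sum>t<?n. scaled D (weights I ! (\<pi>' ! t)) * psum (scenarios I) (\<pi>' ! t) t)"
    if "\<pi>' \<in> schedules I" for \<pi>'
    by (rule expected_cost_eq_assignment[where f = f and g = g and pen = pen and \<kappa> = "\<kappa> D",
          OF f pen[OF D_pos] dvd_w dvd_sc that])
  have \<pi>s: "\<pi> \<in> schedules I" using \<pi> by (simp add: schedules_def)
  have "expected_cost f I \<pi> \<le> expected_cost f I \<pi>'" if "\<pi>' \<in> schedules I" for \<pi>'
  proof -
    \<comment> \<open>Scaling by the positive factor \<open>D * D * \<kappa> D\<close>, the same for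
      every schedule, preserves minimizers.\<close>
    have "real_of_int D * of_int D * \<kappa> D * expected_cost f I \<pi> \<le>
        real_of_int D * of_int D * \<kappa> D * expected_cost f I \<pi>'"
      unfolding cost[OF \<pi>s] cost[OF that] of_int_le_iff
      by (rule opt) (use that in \<open>simp add: schedules_def\<close>)
    then show ?thesis using D_pos \<kappa>[OF D_pos] by (simp add: mult_le_cancel_left)
  qed
  moreover have "0 \<le> f I \<pi>' d" if "(p, d) \<in> set (scenarios I)" for \<pi>' p d
    unfolding f using w0 g by (intro sum_nonneg mult_nonneg_nonneg) (auto simp: num_jobs_def)
  ultimately have ratio: "CVaR \<alpha> (random_cost f I \<pi>) \<le>
      min (1 / Pr_min I) (1 / (1 - \<alpha>)) * (INF \<pi>'\<in>schedules I. CVaR \<alpha> (random_cost f I \<pi>'))"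
    by (intro CVaR_ratio_of_expected_cost_minimizer[OF I \<alpha>]) blast+
  \<comment> \<open>The outermost call and its variable cost two steps, which accounts for
    \<open>[:2:]\<close> in the time bound.\<close>
  have "ev [enc_instance I] (ECall fMAIN (EVar 0)) (enc_schedule \<pi>) (1 + 1 + t_main)"
    unfolding enc_instance_eq enc_schedule_def by (rule ev_call[OF within_var(1) run])
  then obtain t where t: "returns (prog pe) (enc_instance I) (enc_schedule \<pi>) t" "t \<le> 1 + 1 + t_main"
    unfolding returns_def evaluates_within_def by blast
  have "t \<le> poly (time_poly ?l + [:2:]) ?S"
  proof -
    have "t_main = poly (time_poly ?l) S" by (rule t_main_eq_poly) (rule refl)
    then show ?thesis using t(2) unfolding S_def poly_add by simp
  qed
  then show "\<exists>s\<in>schedules I. \<exists>t. returns (prog pe) (enc_instance I) (enc_schedule s) t \<and>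
      t \<le> poly (time_poly ?l + [:2:]) (val_size (enc_instance I)) \<and>
      CVaR \<alpha> (random_cost f I s) \<le> min (1 / Pr_min I) (1 / (1 - \<alpha>)) *
        (INF s'\<in>schedules I. CVaR \<alpha> (random_cost f I s'))"
    using \<pi>s t(1) ratio by blast
qed

section \<open>The two penalty functions\<close>

definition tardy_body :: expr where
  "tardy_body = EOp Less (efst (efst (EVar 0)))
     (EOp Mul (EOp Add (efst (esnd (EVar 0))) (ELit 1)) (esnd (efst (EVar 0))))"

text \<open>Comparison of the due date with \<open>t + 1\<close> by cross-multiplication;
  \<open>den r\<close> is positive, so the inequality keeps its direction.\<close>

definition tardy_pen :: "rat \<Rightarrow> nat \<Rightarrow> int \<Rightarrow> int" where
  "tardy_pen r t D = (if num r < (int t + 1) * den r then 1 else 0)"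

definition tardiness_body :: expr where
  "tardiness_body =
     ELet (EOp Sub (EOp Mul (EOp Add (efst (esnd (EVar 0))) (ELit 1)) (esnd (esnd (EVar 0))))
       (EOp Mul (efst (efst (EVar 0))) (EOp Div (esnd (esnd (EVar 0))) (esnd (efst (EVar 0))))))
     (EIf (EOp Less (ELit 0) (EVar 0)) (EVar 0) (ELit 0))"

text \<open>\<open>D\<close> times the tardiness, which is integral when \<open>den r\<close>
  divides \<open>D\<close>.\<close>

definition tardiness_pen :: "rat \<Rightarrow> nat \<Rightarrow> int \<Rightarrow> int" where
  "tardiness_pen r t D = max 0 ((int t + 1) * D - scaled D r)"

lemma mult_bound:
  fixes a b Y :: int
  assumes "0 \<le> a" "a \<le> Y" "0 \<le> b" "b \<le> Y"
  shows "0 \<le> a * b" "a * b \<le> Y ^ 2"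
  using assms by (auto simp: power2_eq_square intro!: mult_mono)

lemma le_square: "int N + 1 \<le> Y \<Longrightarrow> x \<le> Y \<Longrightarrow> x \<le> Y ^ 2"
  using power_increasing[of 1 2 Y] by simp

lemma tardy_runs:
  assumes "machine X L N" "good_rat Y r" "t < N" "int N + 1 \<le> Y" "0 < D" "D \<le> Y" "Y ^ 2 \<le> X"
  shows "machine.runs tardy_body fPEN (VCons (enc_rat r) (VCons (vnat t) (VInt D)))
    (VInt (tardy_pen r t D)) (machine.unit_time L)"
proof -
  interpret machine tardy_body X L N by fact
  have r: "0 \<le> num r" "num r \<le> Y" "0 < den r" "den r \<le> Y"
    using assms(2) den_pos[of r] unfolding good_rat_def by auto
  note m = mult_bound[of "int t + 1" Y "den r"] and sq = le_square[OF assms(4)]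
  have X: "\<bar>num r\<bar> \<le> X" "\<bar>den r\<bar> \<le> X" "\<bar>int t\<bar> \<le> X" "\<bar>1::int\<bar> \<le> X" "\<bar>int t + 1\<bar> \<le> X"
    "\<bar>(int t + 1) * den r\<bar> \<le> X"
    using r m sq[of "num r"] sq[of "den r"] sq[of "int t + 1"] assms by auto
  show ?thesis
    apply (rule runsI)
    \<comment> \<open>The first occurrence belongs to the program inside \<open>prog\<close>; only
      the expression being evaluated is unfolded.\<close>
    apply (subst (2) tardy_body_def)
    apply (rule within_conv)
      apply (rule ev_core within_fst_eq within_snd_eq refl enc_rat_eq X)+
     apply (simp add: tardy_pen_def)
    apply (simp add: unit_time_def)
    done
qed

lemma tardiness_pen_bounds:
  assumes "good_rat Y r" "t < N" "int N + 1 \<le> Y" "0 < D" "D \<le> Y"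
  shows "0 \<le> tardiness_pen r t D \<and> tardiness_pen r t D \<le> Y ^ 2"
  using good_rat_scaled[OF assms(1,4,5)] mult_bound[of "int t + 1" Y D] assms
  unfolding tardiness_pen_def by auto

lemma tardiness_runs:
  assumes "machine X L N" "good_rat Y r" "t < N" "int N + 1 \<le> Y" "0 < D" "D \<le> Y" "Y ^ 2 \<le> X"
  shows "machine.runs tardiness_body fPEN (VCons (enc_rat r) (VCons (vnat t) (VInt D)))
    (VInt (tardiness_pen r t D)) (machine.unit_time L)"
proof -
  interpret machine tardiness_body X L N by fact
  have r: "0 \<le> num r" "num r \<le> Y" "0 < den r" "den r \<le> Y"
    using assms(2) den_pos[of r] unfolding good_rat_def by auto
  note m = mult_bound[of "int t + 1" Y D] and sq = le_square[OF assms(4)]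
  note d = good_rat_div[OF assms(2,5,6)] and s = good_rat_scaled[OF assms(2,5,6), unfolded scaled_def]
  let ?z = "(int t + 1) * D - num r * (D div den r)"
  have X: "\<bar>num r\<bar> \<le> X" "\<bar>den r\<bar> \<le> X" "\<bar>int t\<bar> \<le> X" "\<bar>1::int\<bar> \<le> X" "\<bar>int t + 1\<bar> \<le> X"
    "\<bar>D\<bar> \<le> X" "\<bar>D div den r\<bar> \<le> X" "\<bar>(int t + 1) * D\<bar> \<le> X" "\<bar>num r * (D div den r)\<bar> \<le> X"
    "\<bar>0::int\<bar> \<le> X"
    using r m d s sq[of "num r"] sq[of "den r"] sq[of "int t + 1"] sq[of D] sq[of "D div den r"] assms
    by auto
  have z: "\<bar>?z\<bar> \<le> X" using m s assms by linarith
  show ?thesis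
    apply (rule runsI)
    apply (subst (2) tardiness_body_def)
    apply (rule within_conv)
      apply (rule ev_core ev_if_less within_fst_eq within_snd_eq refl enc_rat_eq X z)+
     apply (simp add: tardiness_pen_def scaled_def max_def)
    apply (simp add: unit_time_def)
    done
qed

lemma tardy_pen_eq:
  "real_of_int (tardy_pen r t D) = (if real (t + 1) > of_rat r then 1 else 0)"
proof -
  have "(of_rat r :: real) = of_rat (of_int (num r) / of_int (den r))"
    using rat_eq_num_den[of r] by (rule arg_cong)
  then have "(of_rat r :: real) = of_int (num r) / of_int (den r)" by (simp add: of_rat_divide)
  then have "real (t + 1) > of_rat r \<longleftrightarrow> real_of_int (num r) < of_int ((int t + 1) * den r)"
    using den_pos[of r] by (simp add: pos_divide_less_eq algebra_simps)
  then show ?thesis unfolding tardy_pen_def of_int_less_iff by simp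
qed

lemma tardiness_pen_eq:
  assumes "0 < D" "den r dvd D"
  shows "real_of_int (tardiness_pen r t D) = of_int D * max 0 (real (t + 1) - of_rat r)"
proof -
  have "real_of_int (tardiness_pen r t D) = max 0 (of_int D * (real (t + 1) - of_rat r))"
    unfolding tardiness_pen_def by (simp add: of_int_scaled[OF assms(2)] algebra_simps of_int_max)
  then show ?thesis using assms(1) by (simp add: max_mult_distrib_left)
qed

theorem theorem10:
  fixes \<alpha> :: real
    and f :: "sched_instance \<Rightarrow> nat list \<Rightarrow> rat list \<Rightarrow> real"
  assumes "\<alpha> \<in> {0..<1}"
    and "f \<in> {weighted_tardy_jobs, weighted_tardiness}"
  shows "approximable_within sched_instances enc_instance schedules enc_schedule
    (\<lambda>I \<pi>. CVaR \<alpha> (random_cost f I \<pi>))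
    (\<lambda>I. min (1 / Pr_min I) (1 / (1 - \<alpha>)))"
proof -
  have \<alpha>: "0 \<le> \<alpha>" "\<alpha> < 1" using assms(1) by auto
  consider "f = weighted_tardy_jobs" | "f = weighted_tardiness" using assms(2) by blast
  then show ?thesis
  proof cases
    case 1
    show ?thesis
    \<comment> \<open>A unit penalty is already an integer, so \<open>\<kappa>\<close> is 1.\<close>
    proof (rule approximable_by_assignment[OF \<alpha>, where pe = tardy_body and pen = tardy_pen and \<kappa> = "\<lambda>_. 1"
          and g = "\<lambda>t r. if real t > of_rat r then 1 else 0"])
      show "0 \<le> tardy_pen r t D \<and> tardy_pen r t D \<le> Y ^ 2" if "int N + 1 \<le> Y" for r t D Y N
        using le_square[OF that, of 1] that unfolding tardy_pen_def by auto
    qed (auto simp: 1 weighted_tardy_jobs_def unit_penalty_def tardy_pen_eq intro: tardy_runs)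
  next
    case 2
    show ?thesis
    \<comment> \<open>A tardiness can be fractional through the due date, so here
      \<open>\<kappa>\<close> is a third factor \<open>D\<close>.\<close>
    proof (rule approximable_by_assignment[OF \<alpha>, where pe = tardiness_body and pen = tardiness_pen
          and \<kappa> = of_int and g = "\<lambda>t r. max 0 (real t - of_rat r)"])
      show "real_of_int (tardiness_pen r t D) = of_int D * max 0 (real (t + 1) - of_rat r)"
        if "0 < D" "den r dvd D" for r t D by (rule tardiness_pen_eq[OF that])
    qed (use tardiness_pen_bounds in \<open>auto simp: 2 weighted_tardiness_def tardiness_def intro: tardiness_runs\<close>)
  qed
qed

end
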